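(* Let $n,m$ be nonnegative integers with $n\ge m+1$. For any $\varphi\in\mathcal{LP}_m''$ one has $$\sum_{i=1}^{n-m}x_i(\varphi(D)[Q])\log x_i(\varphi(D)[Q])\le\sum_{i=1}^{n-m}x_i(\varphi(D)[P])\log x_i(\varphi(D)[P]),$$ $$\sum_{i=1}^{n-m}[x_i(\varphi(D)[Q])]^k\le\sum_{i=1}^{n-m}[x_i(\varphi(D)[P])]^k,\quad k\in[1,\infty),$$ $$r(r-1)\sum_{i=1}^{n-m}[x_i(\varphi(D)[Q])]^r\le r(r-1)\sum_{i=1}^{n-m}[x_i(\varphi(D)[P])]^r,\quad r\in\mathbb{R},$$ for all polynomials $P,Q\in\mathcal{H}_n$ with positive zeros that satisfy $Q\preccurlyeq P$.
   Context: $\mathcal{H}_n$ denotes the set of monic univariate polynomials of degree $n$ all of whose zeros are real. For a polynomial $P$ of degree $d\ge1$, $x_1(P),\dots,x_d(P)$ denote its zeros counted with multiplicity. Spectral order: for real $n$-tuples $X,Y$ write $X\prec Y$ if $\sum_{i=1}^n f(x_i)\le\sum_{i=1}^n f(y_i)$ for every convex $f:\mathbb{R}\to\mathbb{R}$ (equivalently, $X=AY$ as column vectors for some doubly stochastic matrix $A$). For $P,Q\in\mathcal{H}_n$ write $Q\preccurlyeq P$ if the tuple of zeros of $Q$ is $\prec$ the tuple of zeros of $P$. $\mathcal{LP}_m''$ is the class of entire functions of the form $\varphi(x)=cx^me^{bx}\prod_{k=1}^\infty(1-\alpha_kx)$ with $c\in\mathbb{R}\setminus\{0\}$, $b\le0$,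 $\alpha_k\ge0$ and $\sum_k\alpha_k<\infty$. With $D=d/dx$ and $\varphi(x)=\sum_ka_kx^k$, $\varphi(D)[P]=\sum_ka_kP^{(k)}$. If $P\in\mathcal{H}_n$ has only positive zeros, $\varphi\in\mathcal{LP}_m''$ and $n\ge m+1$, then $\varphi(D)[P]$ has degree $n-m$ and all its zeros are real and positive, so that the expressions in the claim are well defined. *)

theory Defs
  imports "HOL-Complex_Analysis.Complex_Analysis" "HOL-Computational_Algebra.Computational_Algebra"
begin

text \<open>The condition on the zeros is about all complex zeros, hence the passage to
  \<^typ>\<open>complex poly\<close>. Real coefficients lose nothing: a monic polynomial with only real zeros
  has real coefficients.\<close>

definition hyperbolic_polys :: "nat \<Rightarrow> real poly set" where
  "hyperbolic_polys n =
     {P. lead_coeff P = 1 \<and> degree P = n \<and>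
         (\<forall>z. poly (map_poly complex_of_real P) z = 0 \<longrightarrow> z \<in> \<real>)}"

text \<open>\<open>zero_of P i\<close> is the \<open>i\<close>-th zero, counted from \<open>1\<close>, of a polynomial with only real zeros.
  They are listed in increasing order; every use below is symmetric in the zeros. Outside the
  range \<open>1 \<le> i \<le> degree P\<close>, or if some zeros are not real, the value carries no meaning.\<close>

definition zero_of :: "real poly \<Rightarrow> nat \<Rightarrow> real" where
  "zero_of P i = sorted_list_of_multiset (proots P) ! (i - 1)"

definition spectral_le :: "nat \<Rightarrow> (nat \<Rightarrow> real) \<Rightarrow> (nat \<Rightarrow> real) \<Rightarrow> bool" where
  "spectral_le n X Y \<longleftrightarrow>
     (\<forall>f :: real \<Rightarrow> real. convex_on UNIV f \<longrightarrow> (\<Sum>i=1..n. f (X i)) \<le> (\<Sum>i=1..n. f (Y i)))"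

definition poly_spectral_le :: "nat \<Rightarrow> real poly \<Rightarrow> real poly \<Rightarrow> bool" where
  "poly_spectral_le n Q P \<longleftrightarrow> spectral_le n (zero_of Q) (zero_of P)"

text \<open>The product is indexed from \<open>0\<close>. It converges in the sense of \<^const>\<open>prodinf\<close> at every
  point, since \<open>\<alpha>\<close> is summable.\<close>

definition LP'' :: "nat \<Rightarrow> (complex \<Rightarrow> complex) set" where
  "LP'' m =
     {\<phi>. \<exists>(c::real) (b::real) (\<alpha> :: nat \<Rightarrow> real).
        c \<noteq> 0 \<and> b \<le> 0 \<and> (\<forall>k. \<alpha> k \<ge> 0) \<and> summable \<alpha> \<and>
        (\<forall>x. \<phi> x = of_real c * x ^ m * exp (of_real b * x) * (\<Prod>k. 1 - of_real (\<alpha> k) * x))}"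

text \<open>The Taylor coefficients at \<open>0\<close> of a function in \<^const>\<open>LP''\<close> are real, so \<^const>\<open>Re\<close> only
  changes their type. Derivatives of order above \<open>degree P\<close> vanish, so the sum is finite.\<close>

definition diff_op :: "(complex \<Rightarrow> complex) \<Rightarrow> real poly \<Rightarrow> real poly" where
  "diff_op \<phi> P =
     (\<Sum>k\<le>degree P. smult (Re (fps_nth (fps_expansion \<phi> 0) k)) ((pderiv ^^ k) P))"

end

theory Submission
  imports Defs
begin

text \<open>
  Up to constants, \<open>\<phi>(D)\<close> is a limit of products of a shift, derivatives and factors
  \<open>1 - \<alpha> D\<close>, so it suffices that \<open>P \<mapsto> P' - \<lambda> P\<close> with \<open>\<lambda> \<ge> 0\<close> preserves the spectral order. By
  Hardy-Littlewood-Polya one may assume that \<open>Q\<close> arises from \<open>P\<close> by moving two zeros \<open>a < b\<close>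
  towards each other by the same amount. The number of zeros of \<open>P' - \<lambda> P\<close> below a point \<open>t\<close> is
  the number of zeros of \<open>P\<close> below \<open>t\<close>, minus one if \<open>P'(t) / P(t) > \<lambda>\<close>. Comparing
  \<open>1 / (t - a) + 1 / (t - b)\<close> before and after the move shows that all new zeros left of
  \<open>(a + b) / 2\<close> have moved right and all those right of it have moved left, with unchanged sum;
  this implies majorization. In the limit, the zeros converge monotonically. Finally, a function
  that is convex on the positive half-line only is replaced by a maximum of finitely many of its
  tangents.
\<close>

section \<open>Majorization and two-point pinches\<close>

text \<open>The zeros of P' - \<lambda> P are not explicit in those of P, and following them along a
  deformation would need care at multiple zeros. Counting avoids this: P' / P is explicit in the
  zeros of P and strictly decreasing between neighbouring ones, so comparing it with \<lambda> at a
  single point settles the count there, whatever the multiplicities. All signs push in one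
  direction. The translation with b \<le> 0 moves the zeros to the right, and for \<lambda> \<ge> 0
  the i-th smallest zero of P' - \<lambda> P is never left of that of P. Hence positivity persists,
  and the zeros of the partial products converge by monotonicity alone, without any theorem on the
  continuity of roots.\<close>

definition majorized :: "real multiset \<Rightarrow> real multiset \<Rightarrow> bool" where
  "majorized X Y \<longleftrightarrow>
     (\<forall>f :: real \<Rightarrow> real. convex_on UNIV f \<longrightarrow> (\<Sum>x\<in>#X. f x) \<le> (\<Sum>y\<in>#Y. f y))"

text \<open>Tests majorization on hinges only, next to size and sum. Unlike the condition for all
  convex functions, this can be re-established by hand after both sides have been changed, as an
  induction on the size requires.\<close>

definition hinge_le :: "real multiset \<Rightarrow> real multiset \<Rightarrow> bool" where
  "hinge_le X Y \<longleftrightarrow> size X = size Y \<and> \<Sum>\<^sub># X = \<Sum>\<^sub># Y \<and>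
     (\<forall>t. (\<Sum>x\<in>#X. max 0 (x - t)) \<le> (\<Sum>y\<in>#Y. max 0 (y - t)))"

lemma majorized_refl: "majorized X X"
  by (simp add: majorized_def)

lemma majorized_trans: "majorized X Y \<Longrightarrow> majorized Y Z \<Longrightarrow> majorized X Z"
  unfolding majorized_def by (meson order_trans)

lemma convex_on_affine: "convex_on UNIV (\<lambda>x::real. a * x + b)"
  by (rule convex_onI) (auto simp: algebra_simps)

lemma convex_on_hinge: "convex_on UNIV (\<lambda>x::real. max 0 (x - t))"
proof (rule convex_onI)
  fix u x y :: real assume u: "0 < u" "u < 1"
  have "(1 - u) * (x - t) \<le> (1 - u) * max 0 (x - t)" "u * (y - t) \<le> u * max 0 (y - t)"
    using u by (auto intro!: mult_left_mono)
  moreover have "0 \<le> (1 - u) * max 0 (x - t)" "0 \<le> u * max 0 (y - t)"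
    using u by auto
  moreover have "(1 - u) *\<^sub>R x + u *\<^sub>R y - t = (1 - u) * (x - t) + u * (y - t)"
    by (simp add: algebra_simps)
  ultimately show "max 0 ((1 - u) *\<^sub>R x + u *\<^sub>R y - t) \<le> (1 - u) * max 0 (x - t) + u * max 0 (y - t)"
    by linarith
qed auto

lemma sum_mset_affine: "(\<Sum>x\<in>#X. a * x + b) = a * \<Sum>\<^sub># X + b * real (size X)" for X :: "real multiset"
  by (induction X) (auto simp: algebra_simps)

lemma majorized_size:
  assumes "majorized X Y"
  shows "size X = size Y"
proof -
  have "(\<Sum>x\<in>#X. 0 * x + b) \<le> (\<Sum>y\<in>#Y. 0 * y + b)" for b
    using assms convex_on_affine unfolding majorized_def by blast
  hence "b * real (size X) \<le> b * real (size Y)" for b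
    unfolding sum_mset_affine by simp
  from this[of 1] this[of "-1"] show ?thesis by simp
qed

lemma majorized_sum:
  assumes "majorized X Y"
  shows "\<Sum>\<^sub># X = \<Sum>\<^sub># Y"
proof -
  have "(\<Sum>x\<in>#X. b * x + 0) \<le> (\<Sum>y\<in>#Y. b * y + 0)" for b
    using assms convex_on_affine unfolding majorized_def by blast
  hence "b * \<Sum>\<^sub># X \<le> b * \<Sum>\<^sub># Y" for b
    unfolding sum_mset_affine by simp
  from this[of 1] this[of "-1"] show ?thesis by simp
qed

lemma majorized_imp_hinge_le: "majorized X Y \<Longrightarrow> hinge_le X Y"
  unfolding hinge_le_def
proof (intro conjI allI)
  assume "majorized X Y"
  thus "size X = size Y" "\<Sum>\<^sub># X = \<Sum>\<^sub># Y"
    by (rule majorized_size, rule majorized_sum)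
  show "(\<Sum>x\<in>#X. max 0 (x - t)) \<le> (\<Sum>y\<in>#Y. max 0 (y - t))" for t
    using \<open>majorized X Y\<close> convex_on_hinge[of t] unfolding majorized_def by blast
qed

lemma sum_mset_filter_eq:
  fixes f :: "'a \<Rightarrow> real"
  assumes "\<And>x. x \<in># M \<Longrightarrow> \<not> P x \<Longrightarrow> f x = 0"
  shows "(\<Sum>x\<in>#M. f x) = (\<Sum>x\<in>#filter_mset P M. f x)"
  using assms by (induction M) auto

lemma sum_mset_filter_le:
  fixes f :: "'a \<Rightarrow> real"
  assumes "\<And>x. x \<in># M \<Longrightarrow> 0 \<le> f x"
  shows "(\<Sum>x\<in>#filter_mset P M. f x) \<le> (\<Sum>x\<in>#M. f x)"
  using assms by (induction M) (auto simp: add_increasing)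

lemma sum_mset_diff_const: "(\<Sum>x\<in>#X. x - b) = \<Sum>\<^sub># X - real (size X) * b" for X :: "real multiset"
  by (induction X) (auto simp: algebra_simps)

lemma sum_mset_nonneg:
  fixes f :: "'a \<Rightarrow> real"
  assumes "\<And>x. x \<in># M \<Longrightarrow> 0 \<le> f x"
  shows "0 \<le> (\<Sum>x\<in>#M. f x)"
  using assms by (induction M) auto

lemma sum_mset_le_size:
  fixes f :: "'a \<Rightarrow> real"
  assumes "\<And>x. x \<in># M \<Longrightarrow> f x \<le> K"
  shows "(\<Sum>x\<in>#M. f x) \<le> real (size M) * K"
  using assms
proof (induction M)
  case (add x M)
  have "f x \<le> K" using add.prems[of x] by simp
  moreover have "(\<Sum>x\<in>#M. f x) \<le> real (size M) * K" using add.prems by (intro add.IH) simp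
  ultimately show ?case by (simp add: algebra_simps)
qed simp

lemma sum_mset_ge_size:
  fixes f :: "'a \<Rightarrow> real"
  assumes "\<And>x. x \<in># M \<Longrightarrow> K \<le> f x"
  shows "real (size M) * K \<le> (\<Sum>x\<in>#M. f x)"
  using assms
proof (induction M)
  case (add x M)
  have "K \<le> f x" using add.prems[of x] by simp
  moreover have "real (size M) * K \<le> (\<Sum>x\<in>#M. f x)" using add.prems by (intro add.IH) simp
  ultimately show ?case by (simp add: algebra_simps)
qed simp

text \<open>For t outside the interval from a to x the claim is immediate. Inside it, the gap makes
  the hinge sum of Y affine, with slope minus the number k of elements of Y that are at least x. If
  at most k elements of X exceed t, they are bounded termwise, as none is larger than x. Otherwise
  the hinge sum of X falls from a to t at least at rate k + 1, the rate of the right-hand side, so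
  the inequality at a carries over to t.\<close>

lemma hinge_le_peel:
  assumes le: "hinge_le (add_mset x X) (add_mset a (add_mset b Y))"
    and max: "\<And>z. z \<in># X \<Longrightarrow> z \<le> x"
    and ab: "a < x" "x < b"
    and gap: "\<And>y. y \<in># Y \<Longrightarrow> y \<le> a \<or> x \<le> y"
  shows "hinge_le X (add_mset (a + b - x) Y)"
proof -
  define H where "H M t = (\<Sum>x\<in>#M. max 0 (x - t))" for M and t :: real
  define c where "c = a + b - x"
  have hyp: "max 0 (x - s) + H X s \<le> max 0 (a - s) + max 0 (b - s) + H Y s" for s
    using le unfolding hinge_le_def H_def by (simp add: add.assoc)
  have H0: "0 \<le> H M t" for M t
    unfolding H_def by (rule sum_mset_nonneg) auto
  have *: "H X t \<le> max 0 (c - t) + H Y t" for t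
  proof -
    consider "t \<ge> x" | "t \<le> a" | "a < t" "t < x" by linarith
    thus ?thesis
    proof cases
      case 1
      have "max 0 (z - t) \<le> 0" if "z \<in># X" for z
        using max[OF that] 1 by simp
      hence "H X t \<le> real (size X) * 0"
        unfolding H_def by (rule sum_mset_le_size)
      thus ?thesis using H0[of Y t] by simp
    next
      case 2
      thus ?thesis using hyp[of t] ab by (simp add: c_def)
    next
      case 3
      define YU where "YU = filter_mset (\<lambda>y. x \<le> y) Y"
      define XU where "XU = filter_mset (\<lambda>y. t < y) X"
      have HY: "H Y s = \<Sum>\<^sub># YU - real (size YU) * s" if "a \<le> s" "s \<le> x" for s
      proof -
        have "H Y s = (\<Sum>y\<in>#YU. max 0 (y - s))"
          unfolding H_def YU_def using that by (intro sum_mset_filter_eq) (auto dest: gap)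
        also have "\<dots> = (\<Sum>y\<in>#YU. y - s)"
          using that by (intro arg_cong[of _ _ sum_mset] image_mset_cong) (auto simp: YU_def)
        finally show ?thesis by (simp add: sum_mset_diff_const)
      qed
      have XU_t: "H X t = (\<Sum>y\<in>#XU. max 0 (y - t))"
        unfolding H_def XU_def by (intro sum_mset_filter_eq) auto
      also have "\<dots> = (\<Sum>y\<in>#XU. y - t)"
        by (intro arg_cong[of _ _ sum_mset] image_mset_cong) (auto simp: XU_def)
      finally have HXt: "H X t = \<Sum>\<^sub># XU - real (size XU) * t" by (simp add: sum_mset_diff_const)
      show ?thesis
      proof (cases "size XU \<le> size YU")
        case True
        have "H X t \<le> real (size XU) * (x - t)"
          unfolding XU_t using max 3 by (intro sum_mset_le_size) (auto simp: XU_def)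
        also have "\<dots> \<le> real (size YU) * (x - t)"
          using True 3 by (intro mult_right_mono) auto
        also have "\<dots> \<le> (\<Sum>y\<in>#YU. y - t)"
          by (intro sum_mset_ge_size) (auto simp: YU_def)
        also have "\<dots> = H Y t" using 3 HY[of t] by (simp add: sum_mset_diff_const)
        finally show ?thesis by simp
      next
        case False
        have "\<Sum>\<^sub># XU - real (size XU) * a = (\<Sum>y\<in>#XU. max 0 (y - a))"
          unfolding sum_mset_diff_const[symmetric]
          by (intro arg_cong[of _ _ sum_mset] image_mset_cong) (use 3 in \<open>auto simp: XU_def\<close>)
        also have "\<dots> \<le> H X a"
          unfolding H_def XU_def by (intro sum_mset_filter_le) auto
        finally have XUa: "\<Sum>\<^sub># XU - real (size XU) * a \<le> H X a" .
        have "(real (size YU) + 1) * (t - a) \<le> real (size XU) * (t - a)"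
          using False 3 by (intro mult_right_mono) auto
        hence "H X t \<le> H X a - (real (size YU) + 1) * (t - a)"
          using XUa HXt by (simp add: algebra_simps)
        moreover have "H X a \<le> c - a + H Y a"
          using hyp[of a] ab by (simp add: c_def)
        moreover have "H Y a = H Y t + real (size YU) * (t - a)"
          using HY[of a] HY[of t] 3 by (simp add: algebra_simps)
        ultimately have "H X t \<le> c - t + H Y t" by (simp add: algebra_simps)
        thus ?thesis by linarith
      qed
    qed
  qed
  show ?thesis
    unfolding hinge_le_def c_def[symmetric]
  proof (intro conjI allI)
    show "(\<Sum>x\<in>#X. max 0 (x - t)) \<le> (\<Sum>y\<in>#add_mset c Y. max 0 (y - t))" for t
      using *[of t] by (simp add: H_def)
  qed (use le in \<open>auto simp: hinge_le_def c_def\<close>)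
qed

text \<open>The maximum \<open>x\<close> of \<open>X\<close> is produced in \<open>Y\<close> by pinching the largest element \<open>a < x\<close> of \<open>Y\<close>
  with any element \<open>b > x\<close>, after which \<open>x\<close> can be cancelled on both sides.\<close>

lemma pinch_induct_aux:
  assumes refl: "\<And>M. \<Phi> M M"
    and trans: "\<And>L M N. \<Phi> L M \<Longrightarrow> \<Phi> M N \<Longrightarrow> \<Phi> L N"
    and pinch: "\<And>R a b c d. a \<le> c \<Longrightarrow> c \<le> b \<Longrightarrow> a + b = c + d \<Longrightarrow>
                  \<Phi> (add_mset c (add_mset d R)) (add_mset a (add_mset b R))"
    and "hinge_le X Y"
  shows "\<Phi> (X + R) (Y + R)"
  using \<open>hinge_le X Y\<close>
proof (induction "size X" arbitrary: X Y R)
  case 0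
  thus ?case using refl by (simp add: hinge_le_def)
next
  case (Suc n)
  have neX: "X \<noteq> {#}" using Suc.hyps by auto
  define x where "x = Max_mset X"
  have "x \<in># X" using neX by (simp add: x_def)
  then obtain X' where X: "X = add_mset x X'" by (metis mset_add)
  have max: "z \<le> x" if "z \<in># X" for z using that by (simp add: x_def)
  have n: "n = size X'" using Suc.hyps X by simp
  have szY: "size Y = Suc n" and sumY: "\<Sum>\<^sub># X = \<Sum>\<^sub># Y"
    using Suc.prems Suc.hyps(2) unfolding hinge_le_def by simp_all
  hence neY: "Y \<noteq> {#}" by auto
  show ?case
  proof (cases "x \<in># Y")
    case True
    then obtain Y' where Y: "Y = add_mset x Y'" by (metis mset_add)
    have "hinge_le X' Y'" using Suc.prems unfolding X Y by (auto simp: hinge_le_def)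
    \<comment> \<open>\<Phi> is not assumed to be stable under adding a common element; R collects
      the elements cancelled so far.\<close>
    from Suc.hyps(1)[OF n this, of "add_mset x R"] show ?thesis by (simp add: X Y)
  next
    case False
    have "\<exists>b\<in>#Y. x < b"
    proof (rule ccontr)
      assume "\<not> (\<exists>b\<in>#Y. x < b)"
      hence *: "y < x" if "y \<in># Y" for y
        using False that by (cases "x = y") (auto simp: not_less)
      \<comment> \<open>At this t the hinge sum of Y vanishes, while x alone contributes x - t > 0
        to that of X.\<close>
      define t where "t = Max_mset Y"
      have t: "t < x" using * neY by (simp add: t_def)
      have "(\<Sum>y\<in>#Y. max 0 (y - t)) \<le> real (size Y) * 0"
        by (rule sum_mset_le_size) (auto simp: t_def)
      moreover have "0 \<le> (\<Sum>y\<in>#X'. max 0 (y - t))" by (rule sum_mset_nonneg) auto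
      ultimately show False using Suc.prems t unfolding hinge_le_def X
        by (auto dest!: spec[of _ t])
    qed
    then obtain b where b: "b \<in># Y" "x < b" by auto
    \<comment> \<open>Otherwise the sum of Y would exceed (n + 1) x because of b, whereas the sum of
      X is at most that.\<close>
    have "\<exists>a\<in>#Y. a < x"
    proof (rule ccontr)
      assume "\<not> (\<exists>a\<in>#Y. a < x)"
      moreover obtain Y1 where Y1: "Y = add_mset b Y1" using b(1) by (metis mset_add)
      ultimately have "x \<le> y" if "y \<in># Y1" for y using that by (auto simp: not_less)
      hence 1: "real (size Y1) * x \<le> (\<Sum>y\<in>#Y1. y)"
        by (rule sum_mset_ge_size)
      have 2: "\<Sum>\<^sub># Y = b + (\<Sum>y\<in>#Y1. y)" by (simp add: Y1)
      have "(\<Sum>y\<in>#X. y) \<le> real (size X) * x"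
        by (rule sum_mset_le_size) (rule max)
      hence 3: "\<Sum>\<^sub># X \<le> real (size X) * x" by simp
      have 4: "real (size Y1) = real n" using szY unfolding Y1 by simp
      have 5: "real (size X) = real n + 1" using Suc.hyps(2)[symmetric] by simp
      have "b + real n * x \<le> (real n + 1) * x" using 1 2 3 sumY unfolding 4 5 by linarith
      thus False using b by (simp add: algebra_simps)
    qed
    hence ne: "{y\<in>set_mset Y. y < x} \<noteq> {}" by auto
    define a where "a = Max {y\<in>set_mset Y. y < x}"
    have a: "a \<in># Y" "a < x" using Max_in[OF _ ne] by (auto simp: a_def)
    have gap: "y \<le> a \<or> x \<le> y" if "y \<in># Y" for y
      using Max_ge[of "{y\<in>set_mset Y. y < x}" y] that unfolding a_def by fastforce
    obtain Y' where Y: "Y = add_mset a (add_mset b Y')"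
      using a b by (metis insert_noteq_member mset_add order_less_asym)
    have "hinge_le X' (add_mset (a + b - x) Y')"
    proof (rule hinge_le_peel)
      show "a < x" "x < b" by fact+
      show "hinge_le (add_mset x X') (add_mset a (add_mset b Y'))" using Suc.prems X Y by simp
      show "z \<le> x" if "z \<in># X'" for z using max[of z] that unfolding X by simp
      show "y \<le> a \<or> x \<le> y" if "y \<in># Y'" for y using gap[of y] that unfolding Y by simp
    qed
    from Suc.hyps(1)[OF n this, of "add_mset x R"]
    have 1: "\<Phi> (X + R) (add_mset x (add_mset (a + b - x) (Y' + R)))"
      by (simp add: X add_mset_commute)
    have 2: "\<Phi> (add_mset x (add_mset (a + b - x) (Y' + R))) (add_mset a (add_mset b (Y' + R)))"
      by (rule pinch) (use a b in auto)
    from trans[OF 1 2] show ?thesis by (simp add: Y)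
  qed
qed

text \<open>The Hardy-Littlewood-Polya reduction in the form of an induction rule: monotonicity of a
  map on multisets needs to be checked on pinches only. The order c \<le> d costs nothing, as the
  two names can be swapped.\<close>

lemma pinch_induct [consumes 1, case_names refl trans pinch]:
  assumes "majorized X Y"
    and refl: "\<And>M. \<Phi> M M"
    and trans: "\<And>L M N. \<Phi> L M \<Longrightarrow> \<Phi> M N \<Longrightarrow> \<Phi> L N"
    and pinch: "\<And>R a b c d. a \<le> c \<Longrightarrow> c \<le> d \<Longrightarrow> d \<le> b \<Longrightarrow> a + b = c + d \<Longrightarrow>
                  \<Phi> (add_mset c (add_mset d R)) (add_mset a (add_mset b R))"
  shows "\<Phi> X Y"
proof -
  have "\<Phi> (X + {#}) (Y + {#})"
  proof (rule pinch_induct_aux[OF refl trans _ majorized_imp_hinge_le[OF \<open>majorized X Y\<close>]])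
    fix R and a b c d :: real assume *: "a \<le> c" "c \<le> b" "a + b = c + d"
    show "\<Phi> (add_mset c (add_mset d R)) (add_mset a (add_mset b R))"
    proof (cases "c \<le> d")
      case True
      thus ?thesis using * by (intro pinch) auto
    next
      case False
      hence "\<Phi> (add_mset d (add_mset c R)) (add_mset a (add_mset b R))"
        using * by (intro pinch) auto
      thus ?thesis by (simp add: add_mset_commute)
    qed
  qed
  thus ?thesis by simp
qed

section \<open>Counting functions and a single-crossing criterion\<close>

definition count_le :: "real multiset \<Rightarrow> real \<Rightarrow> nat" where
  "count_le M t = size (filter_mset (\<lambda>x. x \<le> t) M)"

lemma sorted_nth_le_iff:
  fixes xs :: "real list"
  assumes "sorted xs" "i < length xs"
  shows "xs ! i \<le> t \<longleftrightarrow> i < length (filter (\<lambda>x. x \<le> t) xs)"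
  using assms
proof (induction xs arbitrary: i)
  case (Cons a xs)
  have *: "filter (\<lambda>x. x \<le> t) xs = []" if "t < a"
    using Cons.prems(1) that by (auto simp: filter_empty_conv)
  show ?case
  proof (cases i)
    case 0
    thus ?thesis using * by (cases "a \<le> t") auto
  next
    case (Suc j)
    hence "xs ! j \<le> t \<longleftrightarrow> j < length (filter (\<lambda>x. x \<le> t) xs)" "j < length xs"
      using Cons by auto
    thus ?thesis using Suc * by (cases "a \<le> t") auto
  qed
qed simp

lemma length_filter_sorted_list_of_multiset:
  "length (filter P (sorted_list_of_multiset M)) = size (filter_mset P M)"
  by (metis mset_filter mset_sorted_list_of_multiset size_mset)

lemma length_sorted_list_of_multiset [simp]: "length (sorted_list_of_multiset M) = size M"
  by (metis mset_sorted_list_of_multiset size_mset)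

text \<open>A Galois connection between order statistics and counts: inequalities between counts at
  all t become inequalities between the i-th smallest elements.\<close>

lemma sorted_list_of_multiset_nth_le_iff:
  assumes "i < size M"
  shows "sorted_list_of_multiset M ! i \<le> t \<longleftrightarrow> i < count_le M t"
  using assms by (subst sorted_nth_le_iff)
    (auto simp: length_filter_sorted_list_of_multiset count_le_def)

lemma sum_mset_sorted_list_of_multiset:
  "(\<Sum>x\<in>#M. f x) = (\<Sum>i<size M. f (sorted_list_of_multiset M ! i))" for f :: "real \<Rightarrow> real"
proof -
  have "(\<Sum>x\<in>#M. f x) = sum_list (map f (sorted_list_of_multiset M))"
    by (metis mset_map mset_sorted_list_of_multiset sum_mset_sum_list)
  thus ?thesis by (simp add: sum_list_sum_nth atLeast0LessThan)
qed

text \<open>The counts say that every order statistic of X lies between \<mu> and the corresponding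
  one of Y, or equals \<mu>. Subtracting a supporting line at \<mu> from f changes both sums equally
  and leaves a function g with its minimum at \<mu> that is monotone on either side, so the sums of
  g compare term by term.\<close>

lemma majorized_of_counts:
  assumes size: "size X = size Y" and sum: "\<Sum>\<^sub># X = \<Sum>\<^sub># Y"
    and below: "\<And>t. t < \<mu> \<Longrightarrow> count_le X t \<le> count_le Y t"
    and above: "\<And>t. t \<ge> \<mu> \<Longrightarrow> count_le Y t \<le> count_le X t"
  shows "majorized X Y"
  unfolding majorized_def
proof (intro allI impI)
  fix f :: "real \<Rightarrow> real" assume f: "convex_on UNIV f"
  \<comment> \<open>The infimum of the difference quotients to the right of \<mu> is the slope of a
    supporting line at \<mu>.\<close>
  define s where "s = Inf ((\<lambda>t. (f \<mu> - f t) / (\<mu> - t)) ` ({\<mu><..} \<inter> UNIV))"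
  have s: "f y \<ge> f \<mu> + s * (y - \<mu>)" for y
    unfolding s_def by (rule convex_le_Inf_differential[OF f]) auto
  define g where "g y = f y - s * y" for y
  have mono: "g x \<le> g y" if xy: "y \<le> x \<and> x \<le> \<mu> \<or> \<mu> \<le> x \<and> x \<le> y" for x y
  proof -
    have "x \<in> closed_segment \<mu> y" using xy by (auto simp: closed_segment_eq_real_ivl)
    then obtain u where u: "0 \<le> u" "u \<le> 1" "x = (1 - u) * \<mu> + u * y"
      by (auto simp: closed_segment_def)
    have "f x \<le> (1 - u) * f \<mu> + u * f y"
      using convex_onD[OF f, of u \<mu> y] u by simp
    moreover have "0 \<le> (1 - u) * (f y - f \<mu> - s * (y - \<mu>))"
      using s[of y] u by (intro mult_nonneg_nonneg) auto
    ultimately show ?thesis unfolding g_def u(3) by (simp add: algebra_simps)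
  qed
  define xs ys where "xs = sorted_list_of_multiset X" "ys = sorted_list_of_multiset Y"
  have "(\<Sum>x\<in>#X. g x) \<le> (\<Sum>y\<in>#Y. g y)"
    unfolding sum_mset_sorted_list_of_multiset size xs_ys_def[symmetric]
  proof (rule sum_mono)
    fix i assume "i \<in> {..<size Y}"
    hence i: "i < size X" "i < size Y" using size by auto
    note le = sorted_list_of_multiset_nth_le_iff[OF i(1), folded xs_ys_def]
      sorted_list_of_multiset_nth_le_iff[OF i(2), folded xs_ys_def]
    have "ys ! i \<le> xs ! i" if "xs ! i < \<mu>"
      using below[OF that] le by (meson order_less_le_trans order_refl)
    moreover have "xs ! i \<le> t" if "t \<ge> \<mu>" "ys ! i \<le> t" for t
      using above[OF that(1)] that(2) le by (meson order_less_le_trans)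
    hence "xs ! i \<le> \<mu> \<or> xs ! i \<le> ys ! i" by (meson linear)
    moreover have "g \<mu> \<le> g y" for y using s[of y] by (simp add: g_def algebra_simps)
    ultimately show "g (xs ! i) \<le> g (ys ! i)"
      using mono[of "ys ! i" "xs ! i"] by (cases "xs ! i" \<mu> rule: linorder_cases) auto
  qed
  moreover have "(\<Sum>x\<in>#M. g x) = (\<Sum>x\<in>#M. f x) - s * \<Sum>\<^sub># M" for M
    by (induction M) (auto simp: g_def algebra_simps)
  ultimately show "(\<Sum>x\<in>#X. f x) \<le> (\<Sum>y\<in>#Y. f y)" using sum by simp
qed

section \<open>Zeros of shifted derivatives\<close>

definition root_poly :: "real multiset \<Rightarrow> real poly" where
  "root_poly M = (\<Prod>x\<in>#M. [:-x, 1:])"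

text \<open>The partial fraction form of P' / P for P = \<open>root_poly M\<close>.\<close>

definition log_deriv :: "real multiset \<Rightarrow> real \<Rightarrow> real" where
  "log_deriv M x = (\<Sum>a\<in>#M. 1 / (x - a))"

lemma root_poly_simps [simp]: "root_poly {#} = 1" "root_poly (add_mset a M) = [:-a, 1:] * root_poly M"
  by (simp_all add: root_poly_def)

lemma monic_root_poly [simp]: "lead_coeff (root_poly M) = 1"
  by (induction M) (simp_all only: root_poly_simps lead_coeff_mult, simp_all)

lemma root_poly_nonzero [simp]: "root_poly M \<noteq> 0"
  using monic_root_poly[of M] by (metis leading_coeff_0_iff zero_neq_one)

lemma degree_root_poly [simp]: "degree (root_poly M) = size M"
  by (induction M) (simp, simp only: root_poly_simps size_add_mset, subst degree_mult_eq, auto)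

lemma coeff_root_poly_size [simp]: "coeff (root_poly M) (size M) = 1"
  using monic_root_poly[of M] by simp

lemma proots_root_poly [simp]: "proots (root_poly M) = M"
  by (induction M) (simp, simp only: root_poly_simps, subst proots_mult, auto)

lemma poly_root_poly_eq_0_iff [simp]: "poly (root_poly M) x = 0 \<longleftrightarrow> x \<in># M"
  by (induction M) auto

lemma poly_root_poly: "poly (root_poly M) x = (\<Prod>a\<in>#M. x - a)"
  by (induction M) (auto simp: algebra_simps)

lemma coeff_root_poly_second:
  assumes "M \<noteq> {#}"
  shows "coeff (root_poly M) (size M - 1) = - \<Sum>\<^sub># M"
  using assms
proof (induction M)
  case (add a M)
  show ?case
  proof (cases "M = {#}")
    case False
    then obtain k where k: "size M = Suc k" by (cases "size M") auto
    have "coeff (root_poly (add_mset a M)) (Suc k) = coeff (root_poly M) k - a * coeff (root_poly M) (Suc k)"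
      by (simp add: coeff_pCons)
    thus ?thesis using add.IH[OF False] k coeff_root_poly_size[of M] by simp
  qed simp
qed simp

lemma pderiv_root_poly:
  assumes "x \<notin># M"
  shows "poly (pderiv (root_poly M)) x = poly (root_poly M) x * log_deriv M x"
  using assms
proof (induction M)
  case (add a M)
  have "pderiv (root_poly (add_mset a M)) = root_poly M + [:-a, 1:] * pderiv (root_poly M)"
    by (simp only: root_poly_simps pderiv_mult) (simp add: pderiv_pCons)
  hence "poly (pderiv (root_poly (add_mset a M))) x = poly (root_poly M) x + (x - a) * poly (pderiv (root_poly M)) x"
    by (simp only:) (simp add: algebra_simps)
  also have "\<dots> = poly (root_poly M) x * ((x - a) * (1 / (x - a) + log_deriv M x))"
    using add by (simp add: algebra_simps)
  also have "(x - a) * (1 / (x - a) + log_deriv M x) = (x - a) * log_deriv (add_mset a M) x"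
    by (simp add: log_deriv_def)
  finally show ?case by (simp only: root_poly_simps poly_mult) (simp add: mult_ac)
qed (simp add: log_deriv_def)

lemma root_poly_proots_dvd:
  assumes "p \<noteq> 0"
  shows "root_poly (proots p) dvd p"
  using assms
proof (induction "size (proots p)" arbitrary: p)
  case (Suc n)
  then obtain a where a: "a \<in># proots p" by (metis size_eq_Suc_imp_elem)
  hence "poly p a = 0" using Suc.prems by simp
  then obtain q where p: "p = [:-a, 1:] * q" by (metis dvdE poly_eq_0_iff_dvd)
  hence "q \<noteq> 0" using Suc.prems by auto
  hence proots: "proots p = add_mset a (proots q)" by (simp only: p) (subst proots_mult, auto)
  hence "root_poly (proots q) dvd q" using Suc.hyps(2) \<open>q \<noteq> 0\<close> by (intro Suc.hyps(1)) auto
  hence "root_poly (add_mset a (proots q)) dvd [:-a, 1:] * q"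
    unfolding root_poly_simps by (rule mult_dvd_mono[OF dvd_refl])
  thus ?case unfolding proots by (subst p)
qed simp

lemma eq_smult_root_poly:
  assumes "p \<noteq> 0" "size (proots p) = degree p"
  shows "p = smult (lead_coeff p) (root_poly (proots p))"
proof -
  obtain q where q: "p = root_poly (proots p) * q" using root_poly_proots_dvd[OF assms(1)] by (rule dvdE)
  hence "q \<noteq> 0" using assms by auto
  hence "degree p = size (proots p) + degree q"
    by (metis degree_mult_eq degree_root_poly root_poly_nonzero q)
  hence "degree q = 0" using assms(2) by simp
  then obtain c where c: "q = [:c:]" by (rule degree_eq_zeroE)
  hence *: "p = smult c (root_poly (proots p))" using q by simp
  hence "lead_coeff p = c" by (metis lead_coeff_smult monic_root_poly mult.right_neutral)
  thus ?thesis using * by simp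
qed

section \<open>Logarithmic derivative and location of the zeros of P' - \<lambda> P\<close>

lemma log_deriv_strict_decreasing:
  assumes "x < y" "M \<noteq> {#}" "\<And>a. a \<in># M \<Longrightarrow> a < x \<or> y < a"
  shows "log_deriv M y < log_deriv M x"
proof -
  have le: "1 / (y - a) < 1 / (x - a)" if "a \<in># M" for a
  proof -
    have "0 < (y - a) * (x - a)"
      using assms(1) assms(3)[OF that] by (auto simp: zero_less_mult_iff)
    hence "1 / (x - a) - 1 / (y - a) = (y - x) / ((y - a) * (x - a))"
      by (auto simp: divide_simps)
    moreover have "\<dots> > 0" using \<open>0 < (y - a) * (x - a)\<close> assms(1) by simp
    ultimately show ?thesis by linarith
  qed
  have "(\<forall>a\<in>#N. 1 / (y - a) < 1 / (x - a)) \<Longrightarrow> N \<noteq> {#} \<Longrightarrow> log_deriv N y < log_deriv N x" for N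
  proof (induction N)
    case (add a N)
    thus ?case by (cases "N = {#}") (auto simp: log_deriv_def intro: add_strict_mono)
  qed simp
  thus ?thesis using le assms(2) by blast
qed

text \<open>Shifted derivative \<open>P' - \<lambda> P\<close>; up to a constant factor this is \<open>D\<close> for \<open>\<lambda> = 0\<close> and
  \<open>1 - \<alpha> D\<close> for \<open>\<lambda> = 1 / \<alpha>\<close>.\<close>

definition sderiv :: "real \<Rightarrow> real multiset \<Rightarrow> real poly" where
  "sderiv l M = pderiv (root_poly M) - smult l (root_poly M)"

definition szeros :: "real \<Rightarrow> real multiset \<Rightarrow> real multiset" where
  "szeros l M = proots (sderiv l M)"

lemma poly_sderiv: "x \<notin># M \<Longrightarrow> poly (sderiv l M) x = poly (root_poly M) x * (log_deriv M x - l)"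
  by (simp add: sderiv_def pderiv_root_poly algebra_simps)

lemma degree_pderiv_root_poly: "degree (pderiv (root_poly M)) = size M - 1"
  by (simp add: degree_pderiv)

lemma degree_sderiv:
  "degree (sderiv l M) = (if l = 0 then size M - 1 else size M)"
proof (cases "l = 0 \<or> M = {#}")
  case False
  hence "degree (pderiv (root_poly M)) < degree (smult l (root_poly M))"
    by (simp add: degree_pderiv_root_poly nonempty_has_size)
  hence "degree (sderiv l M) = degree (smult l (root_poly M))"
    unfolding sderiv_def using degree_add_eq_right[of "pderiv (root_poly M)" "- smult l (root_poly M)"] by simp
  thus ?thesis using False by simp
qed (auto simp: sderiv_def degree_pderiv_root_poly)

lemma lead_coeff_sderiv:
  assumes "M \<noteq> {#}"
  shows "lead_coeff (sderiv l M) = (if l = 0 then real (size M) else - l)"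
proof -
  obtain k where k: "size M = Suc k" using assms by (cases "size M") auto
  have "coeff (root_poly M) (Suc (Suc k)) = 0" by (rule coeff_eq_0) (simp add: k)
  moreover have "coeff (root_poly M) (Suc k) = 1" using coeff_root_poly_size[of M] by (simp only: k)
  ultimately show ?thesis
    by (simp only: degree_sderiv k) (auto simp: sderiv_def coeff_pderiv)
qed

lemma sderiv_nonzero: "M \<noteq> {#} \<Longrightarrow> sderiv l M \<noteq> 0"
  using lead_coeff_sderiv[of M l] by (auto split: if_splits)

text \<open>The integrating factor turns P' - l P, up to a positive function, into a derivative, so
  that Rolle's theorem and the mean value theorem can locate its zeros.\<close>

lemma has_derivative_exp_root_poly:
  "((\<lambda>x. exp (- l * x) * poly (root_poly M) x) has_real_derivative exp (- l * x) * poly (sderiv l M) x) (at x)"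
proof -
  have "((\<lambda>x. exp (- l * x)) has_real_derivative exp (- l * x) * (- l)) (at x)"
    by (auto intro!: derivative_eq_intros)
  from DERIV_mult[OF this poly_DERIV] show ?thesis
    by (simp add: sderiv_def algebra_simps)
qed

lemma sderiv_root_between:
  assumes "s \<in># M" "t \<in># M" "s < t"
  obtains z where "s < z" "z < t" "poly (sderiv l M) z = 0"
proof -
  define f where "f x = exp (- l * x) * poly (root_poly M) x" for x
  have deriv: "(f has_real_derivative exp (- l * x) * poly (sderiv l M) x) (at x)" for x
    unfolding f_def by (rule has_derivative_exp_root_poly)
  have "f s = 0" "f t = 0" using assms by (simp_all add: f_def)
  hence "f s = f t" by simp
  moreover have "continuous_on {s..t} f" unfolding f_def by (intro continuous_intros)
  moreover have "f differentiable (at x)" for x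
    using deriv real_differentiable_def by blast
  ultimately obtain z where z: "s < z" "z < t" "(f has_real_derivative 0) (at z)"
    using Rolle[OF assms(3)] by blast
  hence "exp (- l * z) * poly (sderiv l M) z = 0" using DERIV_unique[OF deriv] by blast
  thus ?thesis using that z by simp
qed

text \<open>From s to s + 1 the function exp(- l x) P(x) rises from 0 to a positive value, so P' - l
  P is positive somewhere beyond s; its leading coefficient - l makes it negative
  eventually.\<close>

lemma sderiv_root_above:
  assumes "s \<in># M" "\<And>t. t \<in># M \<Longrightarrow> t \<le> s" "l > 0"
  obtains z where "s < z" "poly (sderiv l M) z = 0"
proof -
  define f where "f x = exp (- l * x) * poly (root_poly M) x" for x
  have M: "M \<noteq> {#}" using assms by auto
  have "\<exists>z>s. z < s + 1 \<and> f (s + 1) - f s = (s + 1 - s) * (exp (- l * z) * poly (sderiv l M) z)"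
    unfolding f_def by (rule MVT2) (use has_derivative_exp_root_poly in auto)
  then obtain z where z: "s < z" "f (s + 1) - f s = exp (- l * z) * poly (sderiv l M) z"
    by auto
  have pos: "(\<Prod>a\<in>#N. s + 1 - a) > 0" if "\<And>t. t \<in># N \<Longrightarrow> t \<le> s" for N
    using that
  proof (induction N)
    case (add x N)
    have "x \<le> s" using add.prems[of x] by simp
    moreover have "(\<Prod>a\<in>#N. s + 1 - a) > 0" using add.prems by (intro add.IH) simp
    ultimately show ?case by simp
  qed simp
  have "f s = 0" using assms by (simp add: f_def)
  moreover have "f (s + 1) > 0" using pos[of M] assms(2) by (simp add: f_def poly_root_poly)
  ultimately have "poly (sderiv l M) z > 0" using z(2) by (simp add: zero_less_mult_iff)
  have "lead_coeff (- sderiv l M) > 0"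
    using lead_coeff_sderiv[OF M, of l] assms(3) by simp
  from poly_pinfty_gt_lc[OF this]
  obtain n where n: "\<And>x. x \<ge> n \<Longrightarrow> poly (- sderiv l M) x \<ge> lead_coeff (- sderiv l M)" by blast
  define w where "w = max n (z + 1)"
  have "poly (sderiv l M) w < 0"
    using n[of w] \<open>lead_coeff (- sderiv l M) > 0\<close> by (simp add: w_def)
  with \<open>poly (sderiv l M) z > 0\<close> have "\<exists>x>z. x < w \<and> poly (sderiv l M) x = 0"
    by (intro poly_IVT_neg) (auto simp: w_def)
  then obtain x where "x > z" "poly (sderiv l M) x = 0" by blast
  thus ?thesis using that[of x] z(1) by simp
qed

lemma count_le_union [simp]: "count_le (A + B) t = count_le A t + count_le B t"
  by (simp add: count_le_def)

lemma count_le_add [simp]: "count_le (add_mset a M) t = (if a \<le> t then 1 else 0) + count_le M t"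
  by (simp add: count_le_def)

lemma count_le_mset_set: "finite A \<Longrightarrow> count_le (mset_set A) t = card {a\<in>A. a \<le> t}"
  by (simp add: count_le_def filter_mset_mset_set)

lemma log_deriv_pos: "M \<noteq> {#} \<Longrightarrow> (\<And>a. a \<in># M \<Longrightarrow> a < x) \<Longrightarrow> log_deriv M x > 0"
proof (induction M)
  case (add a M)
  have "1 / (x - a) > 0" using add.prems(2)[of a] by simp
  moreover have "log_deriv M x \<ge> 0" using add.prems(2) add.IH by (cases "M = {#}") (force simp: log_deriv_def)+
  moreover have "log_deriv (add_mset a M) x = 1 / (x - a) + log_deriv M x" by (simp add: log_deriv_def)
  ultimately show ?case by linarith
qed simp

lemma log_deriv_neg: "M \<noteq> {#} \<Longrightarrow> (\<And>a. a \<in># M \<Longrightarrow> x < a) \<Longrightarrow> log_deriv M x < 0"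
proof (induction M)
  case (add a M)
  have "1 / (x - a) < 0" using add.prems(2)[of a] by simp
  moreover have "log_deriv M x \<le> 0" using add.prems(2) add.IH by (cases "M = {#}") (force simp: log_deriv_def)+
  moreover have "log_deriv (add_mset a M) x = 1 / (x - a) + log_deriv M x" by (simp add: log_deriv_def)
  ultimately show ?case by linarith
qed simp

text \<open>A zero of P of multiplicity k + 1 has multiplicity at least k in both P' and P. Off the
  zeros of P the truncated subtraction makes the bound trivial.\<close>

lemma order_sderiv_ge: "count M a - 1 \<le> order a (sderiv l M)" if "M \<noteq> {#}"
proof (cases "a \<in># M")
  case True
  have "[:-a, 1:] ^ count M a dvd root_poly M"
    by (metis count_proots order_1 proots_root_poly root_poly_nonzero)
  then obtain q where q: "root_poly M = [:-a, 1:] ^ count M a * q" by (rule dvdE)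
  obtain k where k: "count M a = Suc k" using True by (metis count_eq_zero_iff not0_implies_Suc)
  have power: "[:-a, 1:] ^ k dvd [:-a, 1:] ^ Suc k" by (rule le_imp_power_dvd) simp
  have "[:-a, 1:] ^ k dvd smult (of_nat (Suc k)) ([:-a, 1:] ^ k) * pderiv [:-a, 1:]"
    by (rule dvd_mult2) (rule dvd_smult, rule dvd_refl)
  hence "[:-a, 1:] ^ k dvd pderiv (root_poly M)"
    unfolding q k pderiv_mult pderiv_power_Suc
    by (intro dvd_add dvd_mult2[OF power]) (rule dvd_mult)
  moreover have "[:-a, 1:] ^ k dvd smult l (root_poly M)"
    unfolding q k by (rule dvd_smult) (rule dvd_mult2[OF power])
  ultimately have "[:-a, 1:] ^ k dvd sderiv l M" unfolding sderiv_def by (rule dvd_diff)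
  thus ?thesis using sderiv_nonzero[OF that] by (simp add: k order_divides)
qed (simp add: not_in_iff)

text \<open>Each distinct zero s of P keeps all but one of its multiplicities and is followed by a
  new zero \<zeta> s before the next zero of P. Beyond the largest zero there is a new one only if l
  > 0; for l = 0 the degree drops instead, which is why T omits the maximum.\<close>

lemma szeros_structure:
  assumes "M \<noteq> {#}" "l \<ge> 0"
  defines "S \<equiv> set_mset M"
  defines "T \<equiv> (if l = 0 then S - {Max S} else S)"
  obtains \<zeta> where "\<And>s. s \<in> T \<Longrightarrow> s < \<zeta> s"
    and "\<And>s t. s \<in> T \<Longrightarrow> t \<in> S \<Longrightarrow> s < t \<Longrightarrow> \<zeta> s < t"
    and "\<And>s. s \<in> T \<Longrightarrow> log_deriv M (\<zeta> s) = l"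
    and "szeros l M = (M - mset_set S) + mset_set (\<zeta> ` T)"
    and "inj_on \<zeta> T"
    and "size (szeros l M) = degree (sderiv l M)"
proof -
  have S: "finite S" "S \<noteq> {}" using assms by auto
  have "\<exists>z. s < z \<and> (\<forall>t\<in>S. s < t \<longrightarrow> z < t) \<and> poly (sderiv l M) z = 0" if s: "s \<in> T" for s
  proof (cases "\<exists>t\<in>S. s < t")
    case True
    define t where "t = Min {t\<in>S. s < t}"
    have "t \<in> {t\<in>S. s < t}" unfolding t_def using S True by (intro Min_in) auto
    hence t: "t \<in> S" "s < t" by auto
    have min: "t \<le> u" if "u \<in> S" "s < u" for u
      unfolding t_def using S that by (intro Min_le) auto
    obtain z where "s < z" "z < t" "poly (sderiv l M) z = 0"
      using sderiv_root_between[of s M t l] t s by (auto simp: S_def T_def split: if_splits)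
    thus ?thesis using min by (meson order_less_le_trans)
  next
    case False
    hence max: "t \<le> s" if "t \<in> S" for t using that by (auto simp: not_less)
    have "Max S = s" using s S max by (intro Max_eqI) (auto simp: T_def split: if_splits)
    hence "l > 0" using s assms(2) by (auto simp: T_def split: if_splits)
    then obtain z where "s < z" "poly (sderiv l M) z = 0"
      using sderiv_root_above[of s M l] s max by (auto simp: S_def T_def split: if_splits)
    thus ?thesis using False by blast
  qed
  then obtain \<zeta> where \<zeta>: "\<And>s. s \<in> T \<Longrightarrow> s < \<zeta> s"
      "\<And>s t. s \<in> T \<Longrightarrow> t \<in> S \<Longrightarrow> s < t \<Longrightarrow> \<zeta> s < t"
      "\<And>s. s \<in> T \<Longrightarrow> poly (sderiv l M) (\<zeta> s) = 0"
    by metis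
  have TS: "T \<subseteq> S" by (auto simp: T_def)
  have "\<zeta> s < \<zeta> t" if "s \<in> T" "t \<in> T" "s < t" for s t
    using \<zeta>(1)[OF that(2)] \<zeta>(2)[OF that(1) _ that(3)] TS that(2) by force
  hence inj: "inj_on \<zeta> T" by (intro linorder_inj_onI') force
  have notS: "\<zeta> s \<notin> S" if "s \<in> T" for s
    using \<zeta>(1)[OF that] \<zeta>(2)[OF that] by blast
  have log_deriv: "log_deriv M (\<zeta> s) = l" if "s \<in> T" for s
    using \<zeta>(3)[OF that] notS[OF that] poly_sderiv[of "\<zeta> s" M l] by (simp add: S_def)
  have finT: "finite T" using S TS finite_subset by blast
  \<comment> \<open>Z holds the zeros known so far, with multiplicity. It is contained in
    \<open>szeros l M\<close> and its size is the full degree, so there are no others.\<close>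
  define Z where "Z = (M - mset_set S) + mset_set (\<zeta> ` T)"
  have "count Z x \<le> count (szeros l M) x" for x
  proof (cases "x \<in> \<zeta> ` T")
    case True
    then obtain s where s: "s \<in> T" "x = \<zeta> s" by auto
    hence "x \<notin># M" using notS by (simp add: S_def)
    hence "count Z x = 1" using True finT by (simp add: Z_def count_mset_set' not_in_iff)
    moreover have "x \<in># szeros l M"
      unfolding szeros_def using s \<zeta>(3) sderiv_nonzero[OF assms(1)] by simp
    ultimately show ?thesis by (simp add: Suc_le_eq)
  next
    case False
    hence "count Z x = count M x - (if x \<in> S then 1 else 0)"
      using finT S by (simp add: Z_def count_mset_set')
    also have "\<dots> = count M x - 1" by (auto simp: S_def not_in_iff)
    also have "\<dots> \<le> count (szeros l M) x"
      unfolding szeros_def count_proots[OF sderiv_nonzero[OF assms(1)]]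
      by (rule order_sderiv_ge) fact
    finally show ?thesis .
  qed
  hence sub: "Z \<subseteq># szeros l M" by (simp add: subseteq_mset_def)
  have subM: "mset_set S \<subseteq># M"
    unfolding S_def by (rule mset_set_set_mset_msubset)
  have "size Z = size M - card S + card T"
    unfolding Z_def size_union using inj subM S by (simp add: size_Diff_submset card_image)
  moreover have "card S \<le> size M" using size_mset_mono[OF subM] by simp
  moreover have "card T = (if l = 0 then card S - 1 else card S)" "card S \<noteq> 0"
    using S by (auto simp: T_def card_Diff_singleton)
  ultimately have szZ: "size Z = degree (sderiv l M)" by (auto simp: degree_sderiv)
  have "size (szeros l M) \<le> size Z"
    unfolding szZ szeros_def by (rule size_proots_le)
  hence "Z = szeros l M" using sub by (metis mset_subset_size not_less subset_mset.le_imp_less_or_eq)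
  with that[of \<zeta>] \<zeta> log_deriv inj szZ show ?thesis unfolding Z_def by metis
qed

lemma size_szeros:
  assumes "M \<noteq> {#}" "l \<ge> 0"
  shows "size (szeros l M) = (if l = 0 then size M - 1 else size M)"
  using szeros_structure[OF assms] degree_sderiv by metis

lemma sderiv_eq:
  assumes "M \<noteq> {#}" "l \<ge> 0"
  shows "sderiv l M = smult (if l = 0 then real (size M) else - l) (root_poly (szeros l M))"
proof -
  have "size (proots (sderiv l M)) = degree (sderiv l M)"
    using size_szeros[OF assms] unfolding szeros_def degree_sderiv by simp
  from eq_smult_root_poly[OF sderiv_nonzero[OF assms(1)] this] lead_coeff_sderiv[OF assms(1), of l]
  show ?thesis unfolding szeros_def by metis
qed

text \<open>Each zero of \<open>P\<close> below \<open>t\<close> is matched with the next zero of \<open>P' - \<lambda> P\<close>; only the match of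
  the last one can lie above \<open>t\<close>, which the sign of \<open>P' / P - \<lambda>\<close> at \<open>t\<close> decides.\<close>

lemma count_le_szeros:
  assumes "M \<noteq> {#}" "l \<ge> 0" "t \<notin># M"
  shows "count_le (szeros l M) t + (if l < log_deriv M t then 1 else 0) = count_le M t"
proof -
  define S where "S = set_mset M"
  define T where "T = (if l = 0 then S - {Max S} else S)"
  obtain \<zeta> where \<zeta>: "\<And>s. s \<in> T \<Longrightarrow> s < \<zeta> s"
    "\<And>s t. s \<in> T \<Longrightarrow> t \<in> S \<Longrightarrow> s < t \<Longrightarrow> \<zeta> s < t"
    "\<And>s. s \<in> T \<Longrightarrow> log_deriv M (\<zeta> s) = l"
    "szeros l M = (M - mset_set S) + mset_set (\<zeta> ` T)" "inj_on \<zeta> T"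
    using szeros_structure[OF assms(1,2)] unfolding S_def T_def by metis
  have S: "finite S" "S \<noteq> {}" using assms by (auto simp: S_def)
  have TS: "T \<subseteq> S" by (auto simp: T_def)
  hence finT: "finite T" using S finite_subset by blast
  define U where "U = {s\<in>S. s \<le> t}"
  define V where "V = {s\<in>T. \<zeta> s \<le> t}"
  \<comment> \<open>The repeated part \<open>M - mset_set S\<close> survives in
    \<open>szeros l M\<close> and cancels; it remains to compare distinct old zeros (U) with new
    ones (V).\<close>
  have "M = (M - mset_set S) + mset_set S"
    unfolding S_def using mset_set_set_mset_msubset[of M] by simp
  hence cM: "count_le M t = count_le (M - mset_set S) t + card U"
    using S by (metis U_def count_le_mset_set count_le_union)
  have "card {z \<in> \<zeta> ` T. z \<le> t} = card (\<zeta> ` V)" by (rule arg_cong[of _ _ card]) (auto simp: V_def)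
  also have "\<dots> = card V" by (rule card_image) (rule inj_on_subset[OF \<zeta>(5)], auto simp: V_def)
  finally have cZ: "count_le (szeros l M) t = count_le (M - mset_set S) t + card V"
    using finT by (simp add: \<zeta>(4) count_le_mset_set)
  have "card V + (if l < log_deriv M t then 1 else 0) = card U"
  proof (cases "U = {}")
    case True
    hence "t < a" if "a \<in># M" for a using that by (auto simp: U_def S_def not_le)
    hence "log_deriv M t < 0" using assms(1) by (intro log_deriv_neg)
    moreover have "V = {}" using True TS \<zeta>(1) by (force simp: U_def V_def)
    ultimately show ?thesis using True assms(2) by simp
  next
    case False
    define m where "m = Max U"
    have finU: "finite U" using S by (simp add: U_def)
    have mU: "m \<in> U" unfolding m_def using finU False by (rule Max_in)
    have mmax: "s \<le> m" if "s \<in> U" for s unfolding m_def using finU that by (rule Max_ge)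
    have m: "m \<in> S" "m < t" using mU assms(3) by (auto simp: U_def S_def order_le_less)
    have split: "s \<le> m \<or> t < s" if "s \<in> S" for s using mmax[of s] that by (auto simp: U_def)
    \<comment> \<open>The new zero that follows s stays below the next old zero, hence below m and
      t.\<close>
    have low: "s \<in> V" if "s \<in> U" "s \<noteq> m" for s
    proof -
      have "s < m" "s \<in> S" using mmax[OF that(1)] that by (auto simp: U_def)
      moreover have "m \<le> Max S" using m S by simp
      ultimately have "s \<in> T" by (auto simp: T_def)
      thus ?thesis using \<zeta>(2)[of s m] \<open>s < m\<close> m by (simp add: V_def)
    qed
    have VU: "V \<subseteq> U" using TS \<zeta>(1) by (force simp: U_def V_def)
    \<comment> \<open>Both \<zeta> m and t lie in the gap to the right of m. There P' / P strictly
      decreases and has the value l at \<zeta> m, so its value at t tells on which side of t the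
      zero \<zeta> m lies.\<close>
    have iff: "m \<in> V \<longleftrightarrow> \<not> l < log_deriv M t"
    proof (cases "m \<in> T")
      case mT: True
      have zm: "m < \<zeta> m" "log_deriv M (\<zeta> m) = l" using \<zeta> mT by auto
      have gap: "s \<le> m \<or> \<zeta> m < s \<and> t < s" if "s \<in> S" for s
        using split[OF that] \<zeta>(2)[OF mT that] m by auto
      show ?thesis
      proof (cases "\<zeta> m" t rule: linorder_cases)
        case less
        have "log_deriv M t < log_deriv M (\<zeta> m)"
          by (rule log_deriv_strict_decreasing) (use less assms(1) gap zm in \<open>force simp: S_def\<close>)+
        thus ?thesis using less zm mT by (simp add: V_def)
      next
        case greater
        have "log_deriv M (\<zeta> m) < log_deriv M t"
          by (rule log_deriv_strict_decreasing) (use greater assms(1) gap m in \<open>force simp: S_def\<close>)+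
        thus ?thesis using greater zm mT by (simp add: V_def)
      qed (use zm mT in \<open>simp add: V_def\<close>)
    next
      \<comment> \<open>Here l = 0 and t lies beyond all zeros of P: no zero \<zeta> m exists, and
        P' / P is positive at t, in agreement with the formula.\<close>
      case mT: False
      hence "l = 0" "m = Max S" using m by (auto simp: T_def split: if_splits)
      hence "a < t" if "a \<in># M" for a using that S m Max_ge[of S a] by (force simp: S_def)
      hence "log_deriv M t > 0" using assms(1) by (intro log_deriv_pos)
      thus ?thesis using mT \<open>l = 0\<close> by (simp add: V_def)
    qed
    show ?thesis
    proof (cases "l < log_deriv M t")
      case True
      hence "V = U - {m}" using low VU iff by blast
      thus ?thesis using True mU finU False by (simp add: card_Diff_singleton card_gt_0_iff)
    next
      case False
      hence "V = U" using low VU iff by blast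
      thus ?thesis using False by simp
    qed
  qed
  thus ?thesis using cM cZ by simp
qed

text \<open>Counts of elements x \<le> t are right-continuous step functions, so t can be moved
  slightly to the right, off the poles of P' / P, without changing them. The bound b keeps the new
  point on the same side of a midpoint.\<close>

lemma exists_generic_above:
  fixes F :: "real set"
  assumes "finite F" "t < b"
  obtains u where "t < u" "u < b" "u \<notin> F" "\<And>x. x \<in> F \<Longrightarrow> x \<le> u \<longleftrightarrow> x \<le> t"
proof -
  define c where "c = Min (insert b {x\<in>F. t < x})"
  have "c \<in> insert b {x\<in>F. t < x}" unfolding c_def using assms by (intro Min_in) auto
  hence c: "t < c" using assms by auto
  have le: "c \<le> x" if "x = b \<or> x \<in> F \<and> t < x" for x
    unfolding c_def using assms that by (intro Min_le) auto
  obtain u where u: "t < u" "u < c" using dense[OF c] by blast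
  have "u < b" using u le[of b] by simp
  moreover have *: "x \<le> u \<longleftrightarrow> x \<le> t" if "x \<in> F" for x
    using le[of x] that u by (cases "t < x") auto
  moreover have "u \<notin> F" using *[of u] u by auto
  ultimately show ?thesis using that u by blast
qed

lemma count_le_cong:
  assumes "\<And>x. x \<in># M \<Longrightarrow> x \<le> u \<longleftrightarrow> x \<le> t"
  shows "count_le M u = count_le M t"
  unfolding count_le_def using assms by (intro arg_cong[of _ _ size] filter_mset_cong) auto

text \<open>The i-th smallest zero never moves left. This keeps zeros positive and later makes the
  iteration monotone.\<close>

lemma count_le_szeros_le:
  assumes "M \<noteq> {#}" "l \<ge> 0"
  shows "count_le (szeros l M) t \<le> count_le M t"
proof -
  obtain u where u: "t < u" "u \<notin> set_mset M \<union> set_mset (szeros l M)"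
      "\<And>x. x \<in> set_mset M \<union> set_mset (szeros l M) \<Longrightarrow> x \<le> u \<longleftrightarrow> x \<le> t"
    using exists_generic_above[of "set_mset M \<union> set_mset (szeros l M)" t "t + 1"]
    by (metis finite_UnI finite_set_mset less_add_one)
  have "count_le (szeros l M) u \<le> count_le M u"
    using count_le_szeros[OF assms, of u] u(2) by (cases "l < log_deriv M u") simp_all
  moreover have "count_le M u = count_le M t" "count_le (szeros l M) u = count_le (szeros l M) t"
    by (rule count_le_cong, rule u(3), simp)+
  ultimately show ?thesis by simp
qed

text \<open>Vieta's formula for the second coefficient. The sum depends on M through its sum and
  size only, so multisets that agree in both still have equal sums afterwards; for l = 1 / \<alpha>
  the increase is \<open>size M * \<alpha>\<close>, which is summable along the infinite
  product.\<close>

lemma sum_szeros: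
  assumes "M \<noteq> {#}" "l > 0"
  shows "\<Sum>\<^sub># (szeros l M) = \<Sum>\<^sub># M + real (size M) / l"
proof -
  obtain k where k: "size M = Suc k" using assms by (cases "size M") auto
  have sz: "size (szeros l M) = Suc k" using size_szeros[of M l] assms k by simp
  hence ne: "szeros l M \<noteq> {#}" by auto
  have M: "coeff (root_poly M) k = - \<Sum>\<^sub># M" "coeff (root_poly M) (Suc k) = 1"
    using coeff_root_poly_second[OF assms(1)] coeff_root_poly_size[of M] unfolding k by simp_all
  have Z: "coeff (root_poly (szeros l M)) k = - \<Sum>\<^sub># (szeros l M)"
    using coeff_root_poly_second[OF ne] unfolding sz by simp
  have "coeff (sderiv l M) k = (- l) * coeff (root_poly (szeros l M)) k"
    using assms by (subst sderiv_eq) auto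
  also have "coeff (sderiv l M) k = real (Suc k) + l * \<Sum>\<^sub># M"
    by (simp add: sderiv_def coeff_pderiv M)
  finally show ?thesis using assms(2) by (simp add: Z k field_simps)
qed

lemma sum_szeros_0:
  assumes "size M \<ge> 2"
  shows "real (size M) * \<Sum>\<^sub># (szeros 0 M) = (real (size M) - 1) * \<Sum>\<^sub># M"
proof -
  have "M \<noteq> {#}" using assms by auto
  obtain k where k: "size M = Suc (Suc k)"
    using assms by (metis add_2_eq_Suc le_Suc_ex)
  have sz: "size (szeros 0 M) = Suc k" using size_szeros[of M 0] \<open>M \<noteq> {#}\<close> k by simp
  hence ne: "szeros 0 M \<noteq> {#}" by auto
  have M: "coeff (root_poly M) (Suc k) = - \<Sum>\<^sub># M"
    using coeff_root_poly_second[OF \<open>M \<noteq> {#}\<close>] unfolding k by simp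
  have Z: "coeff (root_poly (szeros 0 M)) k = - \<Sum>\<^sub># (szeros 0 M)"
    using coeff_root_poly_second[OF ne] unfolding sz by simp
  have "coeff (sderiv 0 M) k = real (size M) * coeff (root_poly (szeros 0 M)) k"
    using \<open>M \<noteq> {#}\<close> by (subst sderiv_eq) auto
  also have "coeff (sderiv 0 M) k = - real (Suc k) * \<Sum>\<^sub># M"
    by (simp add: sderiv_def coeff_pderiv M) (simp add: algebra_simps)
  finally show ?thesis by (simp add: Z k algebra_simps)
qed

section \<open>Effect of a pinch on the zeros of P' - \<lambda> P\<close>

lemma recip_sum_pinch:
  fixes a b c d t :: real
  assumes "a + b = c + d" "(t - a) * (t - b) \<le> (t - c) * (t - d)"
    and "0 < (t - a) * (t - b) * ((t - c) * (t - d))"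
  shows "2 * t \<le> a + b \<Longrightarrow> 1 / (t - a) + 1 / (t - b) \<le> 1 / (t - c) + 1 / (t - d)"
    and "2 * t \<ge> a + b \<Longrightarrow> 1 / (t - c) + 1 / (t - d) \<le> 1 / (t - a) + 1 / (t - b)"
proof -
  define p q where "p = (t - a) * (t - b)" and "q = (t - c) * (t - d)"
  have "p \<noteq> 0" "q \<noteq> 0" using assms(3) by (auto simp: p_def q_def)
  have inv: "1 / q \<le> 1 / p"
  proof -
    have "1 / p - 1 / q = (q - p) / (p * q)" using \<open>p \<noteq> 0\<close> \<open>q \<noteq> 0\<close> by (simp add: field_simps)
    also have "\<dots> \<ge> 0" using assms(2,3) by (simp add: p_def q_def)
    finally show ?thesis by simp
  qed
  have nz: "t - a \<noteq> 0" "t - b \<noteq> 0" "t - c \<noteq> 0" "t - d \<noteq> 0" using assms(3) by auto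
  \<comment> \<open>The numerator 2 t - (a + b) is the same before and after the pinch, so its sign
    alone decides how the order of 1 / p and 1 / q is inherited.\<close>
  have e1: "1 / (t - a) + 1 / (t - b) = (2 * t - (a + b)) * (1 / p)"
    using nz by (simp add: p_def add_frac_eq)
  have e2: "1 / (t - c) + 1 / (t - d) = (2 * t - (a + b)) * (1 / q)"
    using nz assms(1) by (simp add: q_def add_frac_eq)
  show "1 / (t - a) + 1 / (t - b) \<le> 1 / (t - c) + 1 / (t - d)" if "2 * t \<le> a + b"
    unfolding e1 e2 using inv that by (intro mult_left_mono_neg) auto
  show "1 / (t - c) + 1 / (t - d) \<le> 1 / (t - a) + 1 / (t - b)" if "2 * t \<ge> a + b"
    unfolding e1 e2 using inv that by (intro mult_left_mono) auto
qed

lemma log_deriv_add: "log_deriv (add_mset a (add_mset b R)) t = (1 / (t - a) + 1 / (t - b)) + log_deriv R t"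
  by (simp add: log_deriv_def)

lemma majorized_szeros_pinch:
  assumes l: "l \<ge> 0" and ord: "a \<le> c" "c \<le> d" "d \<le> b" and sum: "a + b = c + d"
  shows "majorized (szeros l (add_mset c (add_mset d R))) (szeros l (add_mset a (add_mset b R)))"
proof -
  define X Y where "X = add_mset c (add_mset d R)" and "Y = add_mset a (add_mset b R)"
  have ne: "X \<noteq> {#}" "Y \<noteq> {#}" and size: "size X = size Y" and sumXY: "\<Sum>\<^sub># X = \<Sum>\<^sub># Y"
    using sum by (auto simp: X_def Y_def)
  define F where "F = set_mset X \<union> set_mset Y \<union> set_mset (szeros l X) \<union> set_mset (szeros l Y)"
  have fin: "finite F" by (simp add: F_def)
  define \<mu> where "\<mu> = (a + b) / 2"
  have c\<mu>: "c \<le> \<mu>" "\<mu> \<le> d" using ord sum by (auto simp: \<mu>_def)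
  \<comment> \<open>As the sums agree, the two products differ by the constant c d - a b = (c - a)
    (b - c).\<close>
  have prod_le: "(t - a) * (t - b) \<le> (t - c) * (t - d)" for t
  proof -
    have "(t - c) * (t - d) - (t - a) * (t - b) = c * d - a * b"
      using arg_cong[OF sum, of "\<lambda>z. t * z"] by (simp add: algebra_simps)
    moreover have "0 \<le> (c - a) * (b - c)" using ord by simp
    moreover have "d = a + b - c" using sum by simp
    hence "(c - a) * (b - c) = c * d - a * b" by (simp only:) (simp add: algebra_simps)
    ultimately show ?thesis by simp
  qed
  note pinch = recip_sum_pinch[OF sum prod_le]
  have below: "count_le (szeros l X) t \<le> count_le (szeros l Y) t" if "t < \<mu>" "t \<notin> F" for t
  proof -
    have X: "count_le (szeros l X) t + (if l < log_deriv X t then 1 else 0) = count_le X t"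
      and Y: "count_le (szeros l Y) t + (if l < log_deriv Y t then 1 else 0) = count_le Y t"
      using that(2) by (intro count_le_szeros ne l; simp add: F_def)+
    have nF: "t \<noteq> a" "t \<noteq> b" "t \<noteq> c" "t \<noteq> d" using that by (auto simp: F_def X_def Y_def)
    show ?thesis
    \<comment> \<open>Where a moving zero has passed t, the reciprocals are not comparable in this
      way, but the counts of X and Y already differ by one, which absorbs the correction terms.
      Elsewhere the counts agree, the products have equal sign, and the logarithmic derivatives
      decide.\<close>
    proof (cases "a < t \<and> t < c")
      case True
      hence "count_le X t + 1 = count_le Y t"
        using that c\<mu> ord by (simp add: X_def Y_def)
      thus ?thesis using X Y by (simp split: if_splits)
    next
      case False
      hence eq: "count_le X t = count_le Y t"
        using that c\<mu> ord nF by (auto simp: X_def Y_def)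
      have "0 < (t - a) * (t - b) * ((t - c) * (t - d))"
      proof (cases "t < a")
        case True
        thus ?thesis using ord by (intro mult_pos_pos mult_neg_neg) auto
      next
        case below_a: False
        hence "0 < t - a" "t - b < 0" "0 < t - c" "t - d < 0"
          using False that c\<mu> ord nF by auto
        thus ?thesis by (intro mult_neg_neg mult_pos_neg)
      qed
      hence "log_deriv Y t \<le> log_deriv X t"
        using pinch(1)[of t] that by (simp add: X_def Y_def log_deriv_add \<mu>_def)
      thus ?thesis using X Y eq by (simp split: if_splits)
    qed
  qed
  have above: "count_le (szeros l Y) t \<le> count_le (szeros l X) t" if "t > \<mu>" "t \<notin> F" for t
  proof -
    have X: "count_le (szeros l X) t + (if l < log_deriv X t then 1 else 0) = count_le X t"
      and Y: "count_le (szeros l Y) t + (if l < log_deriv Y t then 1 else 0) = count_le Y t"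
      using that(2) by (intro count_le_szeros ne l; simp add: F_def)+
    have nF: "t \<noteq> a" "t \<noteq> b" "t \<noteq> c" "t \<noteq> d" using that by (auto simp: F_def X_def Y_def)
    show ?thesis
    proof (cases "d < t \<and> t < b")
      case True
      hence "count_le X t = count_le Y t + 1"
        using that c\<mu> ord by (simp add: X_def Y_def)
      thus ?thesis using X Y by (simp split: if_splits)
    next
      case False
      hence eq: "count_le X t = count_le Y t"
        using that c\<mu> ord nF by (auto simp: X_def Y_def)
      have "0 < (t - a) * (t - b) * ((t - c) * (t - d))"
      proof (cases "b < t")
        case True
        thus ?thesis using ord by (intro mult_pos_pos) auto
      next
        case above_b: False
        hence "0 < t - a" "t - b < 0" "0 < t - c" "t - d < 0"
          using False that c\<mu> ord nF by auto
        thus ?thesis by (intro mult_neg_neg mult_pos_neg)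
      qed
      hence "log_deriv X t \<le> log_deriv Y t"
        using pinch(2)[of t] that by (simp add: X_def Y_def log_deriv_add \<mu>_def)
      thus ?thesis using X Y eq by (simp split: if_splits)
    qed
  qed
  have right: "count_le (szeros l M) u = count_le (szeros l M) t"
    if "M = X \<or> M = Y" "\<And>x. x \<in> F \<Longrightarrow> x \<le> u \<longleftrightarrow> x \<le> t" for M u t
    by (rule count_le_cong, rule that(2)) (use that(1) in \<open>auto simp: F_def\<close>)
  have "majorized (szeros l X) (szeros l Y)"
  proof (rule majorized_of_counts[of _ _ \<mu>])
    show "size (szeros l X) = size (szeros l Y)" using ne l size by (simp add: size_szeros)
    show "\<Sum>\<^sub># (szeros l X) = \<Sum>\<^sub># (szeros l Y)"
    proof (cases "l = 0")
      case True
      have "size X \<ge> 2" "size Y \<ge> 2" by (auto simp: X_def Y_def)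
      hence "real (size X) * \<Sum>\<^sub># (szeros 0 X) = real (size X) * \<Sum>\<^sub># (szeros 0 Y)"
        using sum_szeros_0[of X] sum_szeros_0[of Y] unfolding size[symmetric] sumXY[symmetric] by simp
      thus ?thesis using ne True by simp
    next
      case False
      thus ?thesis using l ne size sumXY by (simp add: sum_szeros)
    qed
    show "count_le (szeros l X) t \<le> count_le (szeros l Y) t" if "t < \<mu>" for t
    proof -
      obtain u where u: "t < u" "u < \<mu>" "u \<notin> F" "\<And>x. x \<in> F \<Longrightarrow> x \<le> u \<longleftrightarrow> x \<le> t"
        using exists_generic_above[OF fin \<open>t < \<mu>\<close>] by metis
      have "count_le (szeros l M) u = count_le (szeros l M) t" if "M = X \<or> M = Y" for M
        using that u(4) by (rule right)
      with below[OF u(2,3)] show ?thesis by simp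
    qed
    \<comment> \<open>The midpoint itself is covered, since the auxiliary point u lies strictly to
      the right of t.\<close>
    show "count_le (szeros l Y) t \<le> count_le (szeros l X) t" if "t \<ge> \<mu>" for t
    proof -
      obtain u where u: "t < u" "u \<notin> F" "\<And>x. x \<in> F \<Longrightarrow> x \<le> u \<longleftrightarrow> x \<le> t"
        using exists_generic_above[OF fin, of t "t + 1"] by (metis less_add_one)
      have "\<mu> < u" using that u(1) by simp
      have "count_le (szeros l M) u = count_le (szeros l M) t" if "M = X \<or> M = Y" for M
        using that u(3) by (rule right)
      with above[OF \<open>\<mu> < u\<close> u(2)] show ?thesis by simp
    qed
  qed
  thus ?thesis by (simp add: X_def Y_def)
qed

lemma majorized_szeros:
  assumes "l \<ge> 0" "majorized X Y"
  shows "majorized (szeros l X) (szeros l Y)"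
  using assms(2)
proof (induction rule: pinch_induct)
  case (trans L M N)
  thus ?case by (rule majorized_trans)
qed (use assms(1) in \<open>auto intro: majorized_refl majorized_szeros_pinch\<close>)

section \<open>Differential operators given by power series\<close>

text \<open>With formal power series as symbols the calculus is algebraic: multiplying the symbol by
  \<open>fps_X\<close> means differentiating the result, and convergence is no issue.\<close>

definition fps_op :: "real fps \<Rightarrow> real poly \<Rightarrow> real poly" where
  "fps_op A P = (\<Sum>k\<le>degree P. smult (fps_nth A k) ((pderiv ^^ k) P))"

lemma higher_pderiv_eq_0: "degree P < k \<Longrightarrow> (pderiv ^^ k) P = 0" for P :: "real poly"
  by (rule poly_eqI) (simp add: coeff_higher_pderiv coeff_eq_0)

lemma fps_op_eq:
  assumes "degree P \<le> N"
  shows "fps_op A P = (\<Sum>k\<le>N. smult (fps_nth A k) ((pderiv ^^ k) P))"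
  unfolding fps_op_def using assms
  by (intro sum.mono_neutral_left) (auto simp: higher_pderiv_eq_0)

lemma smult_sum_right: "smult c (sum f A) = (\<Sum>x\<in>A. smult c (f x))" for f :: "'a \<Rightarrow> real poly"
  by (induction A rule: infinite_finite_induct) (simp_all add: smult_add_right)

lemma fps_op_diff: "fps_op (A - B) P = fps_op A P - fps_op B P"
  by (simp add: fps_op_def smult_diff_left sum_subtractf)

lemma fps_op_const: "fps_op (A * fps_const c) P = smult c (fps_op A P)"
  by (simp add: fps_op_def smult_sum_right mult_ac)

lemma fps_op_pderiv: "fps_op A (pderiv P) = pderiv (fps_op A P)"
proof -
  have "fps_op A (pderiv P) = (\<Sum>k\<le>degree P. smult (fps_nth A k) ((pderiv ^^ k) (pderiv P)))"
    by (rule fps_op_eq) (simp add: degree_pderiv)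
  also have "\<dots> = pderiv (fps_op A P)"
    by (simp add: fps_op_def higher_pderiv_sum[of 1, simplified] pderiv_smult funpow_swap1)
  finally show ?thesis .
qed

lemma fps_op_X: "fps_op (A * fps_X) P = pderiv (fps_op A P)"
proof -
  have "fps_op (A * fps_X) P
      = (\<Sum>k\<le>Suc (degree P). smult (fps_nth (A * fps_X) k) ((pderiv ^^ k) P))"
    by (rule fps_op_eq) simp
  also have "\<dots> = (\<Sum>k\<le>degree P. smult (fps_nth A k) ((pderiv ^^ k) (pderiv P)))"
    by (subst sum.atMost_Suc_shift) (simp add: funpow_swap1)
  also have "\<dots> = fps_op A (pderiv P)"
    by (rule fps_op_eq[symmetric]) (simp add: degree_pderiv)
  finally show ?thesis by (simp add: fps_op_pderiv)
qed

lemma fps_op_X_power: "fps_op (A * fps_X ^ m) P = (pderiv ^^ m) (fps_op A P)"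
proof (induction m)
  case (Suc m)
  have "A * fps_X ^ Suc m = A * fps_X ^ m * fps_X" by (simp add: mult_ac)
  thus ?case using Suc by (simp only: fps_op_X) simp
qed simp

lemma fps_op_linear_factor:
  "fps_op (A * (1 - fps_const \<alpha> * fps_X)) P = fps_op A P - smult \<alpha> (pderiv (fps_op A P))"
proof -
  have "A * (1 - fps_const \<alpha> * fps_X) = A - A * fps_X * fps_const \<alpha>"
    by (simp add: algebra_simps)
  thus ?thesis by (simp only: fps_op_diff fps_op_const fps_op_X)
qed

text \<open>Leibniz' rule for a + x P; only two terms survive because x has vanishing second
  derivative.\<close>

lemma higher_pderiv_pCons:
  fixes P :: "real poly"
  shows "(pderiv ^^ Suc k) (pCons a P)
           = smult (real (Suc k)) ((pderiv ^^ k) P) + [:0, 1:] * (pderiv ^^ Suc k) P"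
proof (induction k)
  case (Suc k)
  have "(pderiv ^^ Suc (Suc k)) (pCons a P) = pderiv ((pderiv ^^ Suc k) (pCons a P))" by simp
  also have "\<dots> = smult (real (Suc k)) ((pderiv ^^ Suc k) P)
      + ((pderiv ^^ Suc k) P + [:0, 1:] * (pderiv ^^ Suc (Suc k)) P)"
    unfolding Suc by (simp add: pderiv_add pderiv_smult pderiv_pCons)
  also have "smult (real (Suc k)) ((pderiv ^^ Suc k) P) + ((pderiv ^^ Suc k) P + Q)
      = smult (real (Suc (Suc k))) ((pderiv ^^ Suc k) P) + Q" for Q
    using smult_add_left[of "real (Suc k)" 1 "(pderiv ^^ Suc k) P"] by (simp add: add_ac)
  finally show ?case .
qed (simp add: pderiv_pCons)

text \<open>Taylor's formula: exp(b D) is the translation x \<mapsto> x + b. In the induction,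
  Leibniz' rule and the recursion for the coefficients of the exponential yield a + (b + x) times
  the image of P.\<close>

lemma fps_op_exp: "fps_op (fps_exp b) P = pcompose P [:b, 1:]"
proof (induction P)
  case (pCons a P)
  define e where "e k = fps_nth (fps_exp b) k" for k
  define N where "N = degree P"
  have e: "e (Suc k) * real (Suc k) = b * e k" for k
  proof -
    have "fact k + real k * fact k = real (Suc k) * fact k" by (simp add: algebra_simps)
    thus ?thesis by (simp add: e_def del: of_nat_Suc)
  qed
  have "fps_op (fps_exp b) (pCons a P) = (\<Sum>k\<le>Suc N. smult (e k) ((pderiv ^^ k) (pCons a P)))"
    unfolding e_def by (rule fps_op_eq) (simp add: N_def degree_pCons_le)
  also have "\<dots> = pCons a P + (\<Sum>k\<le>N. smult (e (Suc k)) ((pderiv ^^ Suc k) (pCons a P)))"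
    by (subst sum.atMost_Suc_shift) (simp add: e_def)
  also have "(\<Sum>k\<le>N. smult (e (Suc k)) ((pderiv ^^ Suc k) (pCons a P)))
      = (\<Sum>k\<le>N. smult b (smult (e k) ((pderiv ^^ k) P))
          + [:0, 1:] * smult (e (Suc k)) ((pderiv ^^ Suc k) P))"
    unfolding higher_pderiv_pCons smult_add_right smult_smult e mult_smult_right ..
  also have "\<dots> = smult b (\<Sum>k\<le>N. smult (e k) ((pderiv ^^ k) P))
      + [:0, 1:] * (\<Sum>k\<le>N. smult (e (Suc k)) ((pderiv ^^ Suc k) P))"
    unfolding sum.distrib smult_sum_right sum_distrib_left ..
  also have "(\<Sum>k\<le>N. smult (e (Suc k)) ((pderiv ^^ Suc k) P))
      = (\<Sum>k\<le>Suc N. smult (e k) ((pderiv ^^ k) P)) - P"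
    by (subst sum.atMost_Suc_shift) (simp add: e_def)
  also have "(\<Sum>k\<le>Suc N. smult (e k) ((pderiv ^^ k) P)) = fps_op (fps_exp b) P"
    unfolding e_def by (rule fps_op_eq[symmetric]) (simp add: N_def)
  also have "(\<Sum>k\<le>N. smult (e k) ((pderiv ^^ k) P)) = fps_op (fps_exp b) P"
    unfolding e_def by (rule fps_op_eq[symmetric]) (simp add: N_def)
  finally show ?case using pCons.IH
    by (simp add: pcompose_pCons algebra_simps)
qed (simp add: fps_op_def)

text \<open>Only the finitely many coefficients up to the degree of P enter, so coefficientwise
  convergence is enough.\<close>

lemma fps_op_tendsto:
  assumes "\<And>k. (\<lambda>K. fps_nth (A K) k) \<longlonglongrightarrow> fps_nth B k"
  shows "(\<lambda>K. poly (fps_op (A K) P) x) \<longlonglongrightarrow> poly (fps_op B P) x"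
  unfolding fps_op_def poly_sum poly_smult by (intro tendsto_intros assms)

section \<open>Iterating the factors 1 - \<alpha> D and passing to the limit\<close>

definition factor_zeros :: "real \<Rightarrow> real multiset \<Rightarrow> real multiset" where
  "factor_zeros \<alpha> M = (if \<alpha> = 0 then M else szeros (1 / \<alpha>) M)"

text \<open>Scaling P' - P / \<alpha> by - \<alpha> restores the leading coefficient 1, so no
  constants accumulate along the product. The value \<alpha> = 0 stands apart: as 1 / 0 is 0 in HOL,
  \<open>szeros\<close> would yield the zeros of the derivative there.\<close>

lemma root_poly_factor_zeros:
  assumes "M \<noteq> {#}" "\<alpha> \<ge> 0"
  shows "root_poly (factor_zeros \<alpha> M) = root_poly M - smult \<alpha> (pderiv (root_poly M))"
proof (cases "\<alpha> = 0")
  case False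
  have "smult (- \<alpha>) (sderiv (1 / \<alpha>) M) = root_poly (szeros (1 / \<alpha>) M)"
    using sderiv_eq[of M "1 / \<alpha>"] assms False by simp
  thus ?thesis using False by (simp add: sderiv_def factor_zeros_def smult_diff_right)
qed (simp add: factor_zeros_def)

lemma size_factor_zeros: "M \<noteq> {#} \<Longrightarrow> \<alpha> \<ge> 0 \<Longrightarrow> size (factor_zeros \<alpha> M) = size M"
  by (simp add: factor_zeros_def size_szeros)

lemma sum_factor_zeros:
  "M \<noteq> {#} \<Longrightarrow> \<alpha> \<ge> 0 \<Longrightarrow> \<Sum>\<^sub># (factor_zeros \<alpha> M) = \<Sum>\<^sub># M + real (size M) * \<alpha>"
  by (simp add: factor_zeros_def sum_szeros)

lemma count_le_factor_zeros: "M \<noteq> {#} \<Longrightarrow> \<alpha> \<ge> 0 \<Longrightarrow> count_le (factor_zeros \<alpha> M) t \<le> count_le M t"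
  by (simp add: factor_zeros_def count_le_szeros_le)

lemma majorized_factor_zeros: "\<alpha> \<ge> 0 \<Longrightarrow> majorized X Y \<Longrightarrow> majorized (factor_zeros \<alpha> X) (factor_zeros \<alpha> Y)"
  by (simp add: factor_zeros_def majorized_szeros)

lemma count_le_eq_0_iff: "count_le M t = 0 \<longleftrightarrow> (\<forall>x\<in>#M. t < x)"
  by (auto simp: count_le_def not_le)

lemma prod_mset_sorted_list_of_multiset:
  "(\<Prod>x\<in>#M. f x) = (\<Prod>i<size M. f (sorted_list_of_multiset M ! i))" for f :: "real \<Rightarrow> real"
proof -
  define xs where "xs = sorted_list_of_multiset M"
  have "M = mset (map ((!) xs) [0..<length xs])" unfolding map_nth by (simp add: xs_def)
  also have "\<dots> = image_mset ((!) xs) (mset_set {..<size M})"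
    by (simp add: xs_def atLeast0LessThan)
  finally have "(\<Prod>x\<in>#M. f x) = (\<Prod>x\<in>#image_mset ((!) xs) (mset_set {..<size M}). f x)"
    by (rule arg_cong)
  thus ?thesis
    by (simp add: xs_def prod_unfold_prod_mset image_mset.compositionality o_def)
qed

primrec factor_iter :: "(nat \<Rightarrow> real) \<Rightarrow> real multiset \<Rightarrow> nat \<Rightarrow> real multiset" where
  "factor_iter \<alpha> M 0 = M"
| "factor_iter \<alpha> M (Suc K) = factor_zeros (\<alpha> K) (factor_iter \<alpha> M K)"

lemma factor_iter_props:
  assumes "M \<noteq> {#}" "\<And>k. \<alpha> k \<ge> 0"
  shows "size (factor_iter \<alpha> M K) = size M \<and>
    \<Sum>\<^sub># (factor_iter \<alpha> M K) = \<Sum>\<^sub># M + real (size M) * (\<Sum>k<K. \<alpha> k)"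
proof (induction K)
  case (Suc K)
  hence "factor_iter \<alpha> M K \<noteq> {#}" using assms(1) by (metis size_eq_0_iff_empty)
  thus ?case using Suc assms(2)[of K] by (simp add: size_factor_zeros sum_factor_zeros algebra_simps)
qed simp

text \<open>The \<open>i\<close>-th smallest zero increases along the iteration, and it is bounded because the sum
  of all zeros is.\<close>

lemma factor_iter_limit:
  assumes M: "M \<noteq> {#}" and \<alpha>: "\<And>k. \<alpha> k \<ge> 0" "summable \<alpha>" and pos: "\<And>x. x \<in># M \<Longrightarrow> 0 < x"
  obtains Z where "size Z = size M" "\<And>z. z \<in># Z \<Longrightarrow> 0 < z"
    "\<And>x. (\<lambda>K. poly (root_poly (factor_iter \<alpha> M K)) x) \<longlonglongrightarrow> poly (root_poly Z) x"
    "\<And>f :: real \<Rightarrow> real. continuous_on UNIV f \<Longrightarrow>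
       (\<lambda>K. \<Sum>x\<in>#factor_iter \<alpha> M K. f x) \<longlonglongrightarrow> (\<Sum>x\<in>#Z. f x)"
proof -
  define N where "N = size M"
  define I where "I = factor_iter \<alpha> M"
  define L where "L K i = sorted_list_of_multiset (I K) ! i" for K i
  have size: "size (I K) = N" and sum: "\<Sum>\<^sub># (I K) = \<Sum>\<^sub># M + real N * (\<Sum>k<K. \<alpha> k)" for K
    using factor_iter_props[where \<alpha> = \<alpha> and K = K, OF M \<alpha>(1)] by (simp_all add: I_def N_def)
  have ne: "I K \<noteq> {#}" for K using size[of K] M by (auto simp: N_def)
  have iff: "L K i \<le> t \<longleftrightarrow> i < count_le (I K) t" if "i < N" for K i t
    unfolding L_def using that size by (intro sorted_list_of_multiset_nth_le_iff) simp
  have step: "L K i \<le> L (Suc K) i" if "i < N" for K i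
  proof -
    have "count_le (I (Suc K)) t \<le> count_le (I K) t" for t
      using count_le_factor_zeros[OF ne \<alpha>(1)] by (simp add: I_def)
    moreover have "i < count_le (I (Suc K)) (L (Suc K) i)" using iff[OF that] by blast
    ultimately have "i < count_le (I K) (L (Suc K) i)" by (rule order_less_le_trans[rotated])
    thus ?thesis using iff[OF that] by blast
  qed
  have mono: "incseq (\<lambda>K. L K i)" if "i < N" for i using step[OF that] by (rule incseq_SucI)
  have L_pos: "0 < L K i" if "i < N" for K i
  proof -
    have "count_le M 0 = 0" using pos by (simp add: count_le_eq_0_iff)
    hence "\<not> L 0 i \<le> 0" using iff[OF that, of 0 0] by (simp add: I_def)
    thus ?thesis using incseqD[OF mono[OF that], of 0 K] by simp
  qed
  \<comment> \<open>As all zeros are positive, each one is at most their sum.\<close>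
  have bound: "L K i \<le> \<Sum>\<^sub># M + real N * suminf \<alpha>" if "i < N" for K i
  proof -
    have "L K i \<le> (\<Sum>j<N. L K j)"
      using that L_pos by (intro member_le_sum) (auto intro: less_imp_le)
    also have "\<dots> = \<Sum>\<^sub># (I K)"
      using sum_mset_sorted_list_of_multiset[of "\<lambda>x. x" "I K"] by (simp add: size L_def)
    also have "(\<Sum>k<K. \<alpha> k) \<le> suminf \<alpha>" using \<alpha> by (intro sum_le_suminf) auto
    hence "\<Sum>\<^sub># (I K) \<le> \<Sum>\<^sub># M + real N * suminf \<alpha>"
      unfolding sum by (intro add_left_mono mult_left_mono) auto
    finally show ?thesis .
  qed
  have "\<exists>z. (\<lambda>K. L K i) \<longlonglongrightarrow> z \<and> (\<forall>K. L K i \<le> z)" if "i < N" for i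
    using incseq_convergent[OF mono[OF that], of "\<Sum>\<^sub># M + real N * suminf \<alpha>"] bound[OF that] by metis
  then obtain z where z: "\<And>i. i < N \<Longrightarrow> (\<lambda>K. L K i) \<longlonglongrightarrow> z i"
      "\<And>i K. i < N \<Longrightarrow> L K i \<le> z i" by metis
  define Z where "Z = image_mset z (mset_set {..<N})"
  show ?thesis
  proof (rule that[of Z])
    show "size Z = size M" by (simp add: Z_def N_def)
    show "0 < x" if "x \<in># Z" for x
      using that L_pos z(2) by (auto simp: Z_def) (meson order_less_le_trans)
    show "(\<lambda>K. poly (root_poly (factor_iter \<alpha> M K)) x) \<longlonglongrightarrow> poly (root_poly Z) x" for x
    proof -
      have "poly (root_poly (I K)) x = (\<Prod>i<N. x - L K i)" for K
        unfolding poly_root_poly prod_mset_sorted_list_of_multiset size L_def ..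
      moreover have "poly (root_poly Z) x = (\<Prod>i<N. x - z i)"
        by (simp add: poly_root_poly Z_def prod_unfold_prod_mset image_mset.compositionality o_def)
      moreover have "(\<lambda>K. \<Prod>i<N. x - L K i) \<longlonglongrightarrow> (\<Prod>i<N. x - z i)"
        by (intro tendsto_intros z) auto
      ultimately show ?thesis by (simp add: I_def)
    qed
    show "(\<lambda>K. \<Sum>x\<in>#factor_iter \<alpha> M K. f x) \<longlonglongrightarrow> (\<Sum>x\<in>#Z. f x)"
      if f: "continuous_on UNIV f" for f :: "real \<Rightarrow> real"
    proof -
      have "(\<Sum>x\<in>#I K. f x) = (\<Sum>i<N. f (L K i))" for K
        unfolding sum_mset_sorted_list_of_multiset size L_def ..
      moreover have "(\<Sum>x\<in>#Z. f x) = (\<Sum>i<N. f (z i))"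
        by (simp add: Z_def sum_unfold_sum_mset image_mset.compositionality o_def)
      moreover have "(\<lambda>K. \<Sum>i<N. f (L K i)) \<longlonglongrightarrow> (\<Sum>i<N. f (z i))"
        using f by (intro tendsto_sum continuous_on_tendsto_compose[OF f]) (auto intro: z)
      ultimately show ?thesis by (simp add: I_def)
    qed
  qed
qed

section \<open>Translations, derivatives and partial products acting on zeros\<close>

lemma pcompose_root_poly: "pcompose (root_poly M) [:b, 1:] = root_poly (image_mset (\<lambda>x. x - b) M)"
proof (induction M)
  case (add a M)
  have "pcompose [:- a, 1:] [:b, 1:] = [:- (a - b), 1:]" by (simp add: pcompose_pCons)
  thus ?case using add by (simp only: root_poly_simps pcompose_mult image_mset_add_mset)
qed (simp add: one_pCons)

lemma majorized_shift:
  assumes "majorized X Y"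
  shows "majorized (image_mset (\<lambda>x. x - b) X) (image_mset (\<lambda>x. x - b) Y)"
  unfolding majorized_def
proof (intro allI impI)
  fix f :: "real \<Rightarrow> real" assume f: "convex_on UNIV f"
  have "convex_on UNIV (\<lambda>x. f (x - b))"
  proof (rule convex_onI)
    fix u x y :: real assume u: "0 < u" "u < 1"
    have "(1 - u) *\<^sub>R x + u *\<^sub>R y - b = (1 - u) *\<^sub>R (x - b) + u *\<^sub>R (y - b)"
      by (simp add: algebra_simps)
    thus "f ((1 - u) *\<^sub>R x + u *\<^sub>R y - b) \<le> (1 - u) * f (x - b) + u * f (y - b)"
      using convex_onD[OF f, of u "x - b" "y - b"] u by simp
  qed simp
  thus "(\<Sum>x\<in>#image_mset (\<lambda>x. x - b) X. f x) \<le> (\<Sum>y\<in>#image_mset (\<lambda>x. x - b) Y. f y)"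
    using assms by (simp add: majorized_def image_mset.compositionality o_def)
qed

text \<open>Positivity is carried as \<open>count_le _ 0 = 0\<close>, which the bound on counts
  passes from step to step; m < \<open>size M\<close> keeps every multiset that is differentiated
  nonempty.\<close>

lemma iterated_derivative_zeros:
  assumes "m < size M"
  shows "size ((szeros 0 ^^ m) M) = size M - m"
    and "(\<And>x. x \<in># M \<Longrightarrow> 0 < x) \<Longrightarrow> count_le ((szeros 0 ^^ m) M) 0 = 0"
    and "\<exists>k. k \<noteq> 0 \<and> (pderiv ^^ m) (root_poly M) = smult k (root_poly ((szeros 0 ^^ m) M))"
proof -
  have "size ((szeros 0 ^^ m) M) = size M - m \<and>
    ((\<forall>x\<in>#M. 0 < x) \<longrightarrow> count_le ((szeros 0 ^^ m) M) 0 = 0) \<and>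
    (\<exists>k. k \<noteq> 0 \<and> (pderiv ^^ m) (root_poly M) = smult k (root_poly ((szeros 0 ^^ m) M)))"
    using assms
  proof (induction m)
    case 0
    have "(1 :: real) \<noteq> 0 \<and> root_poly M = smult 1 (root_poly M)" by simp
    thus ?case by (auto simp: count_le_eq_0_iff intro: exI[of _ 1])
  next
    case (Suc m)
    define N where "N = (szeros 0 ^^ m) M"
    from Suc obtain k where N: "size N = size M - m"
        "(\<forall>x\<in>#M. 0 < x) \<longrightarrow> count_le N 0 = 0"
        and k: "k \<noteq> 0" "(pderiv ^^ m) (root_poly M) = smult k (root_poly N)"
      unfolding N_def by auto
    have ne: "N \<noteq> {#}" using N(1) Suc.prems by auto
    have "pderiv (root_poly N) = smult (real (size N)) (root_poly (szeros 0 N))"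
      using sderiv_eq[OF ne, of 0] by (simp add: sderiv_def)
    hence "(pderiv ^^ Suc m) (root_poly M) = smult (k * real (size N)) (root_poly (szeros 0 N))"
      by (simp add: k pderiv_smult)
    moreover have "k * real (size N) \<noteq> 0" using k ne by simp
    moreover have "count_le (szeros 0 N) 0 \<le> count_le N 0" using ne by (simp add: count_le_szeros_le)
    moreover have "size (szeros 0 N) = size M - Suc m" using ne N(1) by (simp add: size_szeros)
    moreover have "(szeros 0 ^^ Suc m) M = szeros 0 N" by (simp add: N_def)
    ultimately show ?case using N(2) by (metis le_zero_eq)
  qed
  thus "size ((szeros 0 ^^ m) M) = size M - m"
    and "(\<And>x. x \<in># M \<Longrightarrow> 0 < x) \<Longrightarrow> count_le ((szeros 0 ^^ m) M) 0 = 0"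
    and "\<exists>k. k \<noteq> 0 \<and> (pderiv ^^ m) (root_poly M) = smult k (root_poly ((szeros 0 ^^ m) M))"
    by auto
qed

lemma majorized_iterated_derivative:
  "majorized X Y \<Longrightarrow> majorized ((szeros 0 ^^ m) X) ((szeros 0 ^^ m) Y)"
  by (induction m) (auto intro: majorized_szeros)

text \<open>The Taylor series of \<phi> with its product truncated. The factors stand in the order
  in which the operators act: translation, D^m, constant, linear factors.\<close>

definition LP_fps :: "nat \<Rightarrow> real \<Rightarrow> real \<Rightarrow> (nat \<Rightarrow> real) \<Rightarrow> nat \<Rightarrow> real fps" where
  "LP_fps m c b \<alpha> K =
     fps_exp b * fps_X ^ m * fps_const c * (\<Prod>k<K. 1 - fps_const (\<alpha> k) * fps_X)"

definition base_zeros :: "nat \<Rightarrow> real \<Rightarrow> real multiset \<Rightarrow> real multiset" where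
  "base_zeros m b M = (szeros 0 ^^ m) (image_mset (\<lambda>x. x - b) M)"

text \<open>The linear factors preserve monic polynomials, so one constant \<kappa> serves all K and
  the limit in K concerns the zeros only.\<close>

lemma fps_op_LP_fps:
  assumes "m < size M" "c \<noteq> 0" "\<And>k. \<alpha> k \<ge> 0"
  obtains \<kappa> where "\<kappa> \<noteq> 0"
    "\<And>K. fps_op (LP_fps m c b \<alpha> K) (root_poly M) = smult \<kappa> (root_poly (factor_iter \<alpha> (base_zeros m b M) K))"
proof -
  define M1 where "M1 = base_zeros m b M"
  obtain k where k: "k \<noteq> 0"
      "(pderiv ^^ m) (root_poly (image_mset (\<lambda>x. x - b) M)) = smult k (root_poly M1)"
    using iterated_derivative_zeros(3)[of m "image_mset (\<lambda>x. x - b) M"] assms(1)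
    unfolding M1_def base_zeros_def by auto
  have "size M1 = size M - m"
    using iterated_derivative_zeros(1)[of m "image_mset (\<lambda>x. x - b) M"] assms(1)
    by (simp add: M1_def base_zeros_def)
  hence ne: "M1 \<noteq> {#}" using assms(1) by auto
  have "fps_op (LP_fps m c b \<alpha> K) (root_poly M) = smult (c * k) (root_poly (factor_iter \<alpha> M1 K))" for K
  proof (induction K)
    case 0
    have "fps_op (LP_fps m c b \<alpha> 0) (root_poly M) = smult c ((pderiv ^^ m) (pcompose (root_poly M) [:b, 1:]))"
      unfolding LP_fps_def by (simp add: fps_op_const fps_op_X_power fps_op_exp)
    thus ?case by (simp add: pcompose_root_poly k)
  next
    case (Suc K)
    have "size (factor_iter \<alpha> M1 K) = size M1"
      using factor_iter_props[where \<alpha> = \<alpha> and K = K, OF ne assms(3)] by simp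
    hence "factor_iter \<alpha> M1 K \<noteq> {#}" using ne by auto
    note esc = root_poly_factor_zeros[OF this assms(3)[of K]]
    have "LP_fps m c b \<alpha> (Suc K) = LP_fps m c b \<alpha> K * (1 - fps_const (\<alpha> K) * fps_X)"
      unfolding LP_fps_def prod.lessThan_Suc by (simp only: mult.assoc)
    thus ?case
      by (simp only: fps_op_linear_factor Suc factor_iter.simps esc)
        (simp add: smult_diff_right pderiv_smult mult_ac)
  qed
  thus ?thesis using that[of "c * k"] assms(2) k(1) unfolding M1_def by simp
qed

lemma majorized_factor_iter:
  assumes "\<And>k. \<alpha> k \<ge> 0" "majorized X Y"
  shows "majorized (factor_iter \<alpha> X K) (factor_iter \<alpha> Y K)"
  using assms by (induction K) (auto intro: majorized_factor_zeros)

text \<open>One sequence of polynomials, two descriptions of its limit: by coefficients it is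
  \<phi>(D)[P], by zeros it is \<kappa> times the polynomial with the limiting zeros. Uniqueness of
  limits identifies the zeros of \<phi>(D)[P].\<close>

lemma fps_op_LP_limit:
  assumes "m < size M" "c \<noteq> 0" "b \<le> 0" "\<And>k. \<alpha> k \<ge> 0" "summable \<alpha>" "\<And>x. x \<in># M \<Longrightarrow> 0 < x"
    and lim: "\<And>k. (\<lambda>K. fps_nth (LP_fps m c b \<alpha> K) k) \<longlonglongrightarrow> fps_nth A k"
  defines "Z \<equiv> proots (fps_op A (root_poly M))"
  shows "size Z = size M - m" and "\<And>z. z \<in># Z \<Longrightarrow> 0 < z"
    and "\<And>f :: real \<Rightarrow> real. continuous_on UNIV f \<Longrightarrow>
       (\<lambda>K. \<Sum>x\<in>#factor_iter \<alpha> (base_zeros m b M) K. f x) \<longlonglongrightarrow> (\<Sum>x\<in>#Z. f x)"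
proof -
  define M1 where "M1 = base_zeros m b M"
  let ?S = "image_mset (\<lambda>x. x - b) M"
  have size: "size M1 = size M - m"
    using iterated_derivative_zeros(1)[of m ?S] assms(1) by (simp add: M1_def base_zeros_def)
  hence ne: "M1 \<noteq> {#}" using assms(1) by auto
  have "0 < x" if "x \<in># ?S" for x
    using that assms(3) assms(6) by (fastforce dest: assms(6))
  hence "count_le M1 0 = 0"
    unfolding M1_def base_zeros_def using assms(1) by (intro iterated_derivative_zeros(2)) auto
  hence pos: "0 < x" if "x \<in># M1" for x using that by (simp add: count_le_eq_0_iff)
  obtain Z' where Z': "size Z' = size M1" "\<And>z. z \<in># Z' \<Longrightarrow> 0 < z"
    "\<And>x. (\<lambda>K. poly (root_poly (factor_iter \<alpha> M1 K)) x) \<longlonglongrightarrow> poly (root_poly Z') x"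
    "\<And>f :: real \<Rightarrow> real. continuous_on UNIV f \<Longrightarrow>
       (\<lambda>K. \<Sum>x\<in>#factor_iter \<alpha> M1 K. f x) \<longlonglongrightarrow> (\<Sum>x\<in>#Z'. f x)"
    using factor_iter_limit[OF ne assms(4,5) pos] by metis
  obtain \<kappa> where \<kappa>: "\<kappa> \<noteq> 0"
    "\<And>K. fps_op (LP_fps m c b \<alpha> K) (root_poly M) = smult \<kappa> (root_poly (factor_iter \<alpha> M1 K))"
    using fps_op_LP_fps[where \<alpha> = \<alpha> and b = b, OF assms(1,2,4)] unfolding M1_def by metis
  have "poly (fps_op A (root_poly M)) x = poly (smult \<kappa> (root_poly Z')) x" for x
  proof (rule LIMSEQ_unique)
    show "(\<lambda>K. poly (fps_op (LP_fps m c b \<alpha> K) (root_poly M)) x) \<longlonglongrightarrow> poly (fps_op A (root_poly M)) x"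
      by (rule fps_op_tendsto[OF lim])
    show "(\<lambda>K. poly (fps_op (LP_fps m c b \<alpha> K) (root_poly M)) x) \<longlonglongrightarrow> poly (smult \<kappa> (root_poly Z')) x"
      unfolding \<kappa> poly_smult by (intro tendsto_intros Z')
  qed
  hence "fps_op A (root_poly M) = smult \<kappa> (root_poly Z')" by (simp add: poly_eq_poly_eq_iff[symmetric] fun_eq_iff)
  hence Z: "Z = Z'" using \<kappa>(1) by (simp add: Z_def)
  show "size Z = size M - m" and "\<And>z. z \<in># Z \<Longrightarrow> 0 < z"
    and "\<And>f :: real \<Rightarrow> real. continuous_on UNIV f \<Longrightarrow>
       (\<lambda>K. \<Sum>x\<in>#factor_iter \<alpha> (base_zeros m b M) K. f x) \<longlonglongrightarrow> (\<Sum>x\<in>#Z. f x)"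
    using Z' Z size unfolding M1_def by auto
qed

text \<open>The inequality holds for every partial product, and a convex function on the whole line
  is continuous, so it survives the limit.\<close>

lemma majorized_fps_op:
  assumes "m < size X" "c \<noteq> 0" "b \<le> 0" "\<And>k. \<alpha> k \<ge> 0" "summable \<alpha>"
    and pos: "\<And>x. x \<in># X \<Longrightarrow> 0 < x" "\<And>y. y \<in># Y \<Longrightarrow> 0 < y"
    and lim: "\<And>k. (\<lambda>K. fps_nth (LP_fps m c b \<alpha> K) k) \<longlonglongrightarrow> fps_nth A k"
    and maj: "majorized X Y"
  shows "majorized (proots (fps_op A (root_poly X))) (proots (fps_op A (root_poly Y)))"
  unfolding majorized_def
proof (intro allI impI)
  fix f :: "real \<Rightarrow> real" assume f: "convex_on UNIV f"
  hence cont: "continuous_on UNIV f" by (intro convex_on_continuous) auto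
  have Y: "m < size Y" using majorized_size[OF maj] assms(1) by simp
  have "majorized (base_zeros m b X) (base_zeros m b Y)"
    unfolding base_zeros_def by (intro majorized_iterated_derivative majorized_shift maj)
  hence "majorized (factor_iter \<alpha> (base_zeros m b X) K) (factor_iter \<alpha> (base_zeros m b Y) K)" for K
    by (rule majorized_factor_iter[OF assms(4)])
  hence le: "(\<Sum>x\<in>#factor_iter \<alpha> (base_zeros m b X) K. f x)
      \<le> (\<Sum>x\<in>#factor_iter \<alpha> (base_zeros m b Y) K. f x)" for K
    using f unfolding majorized_def by blast
  show "(\<Sum>x\<in>#proots (fps_op A (root_poly X)). f x) \<le> (\<Sum>x\<in>#proots (fps_op A (root_poly Y)). f x)"
  proof (rule LIMSEQ_le)
    show "(\<lambda>K. \<Sum>x\<in>#factor_iter \<alpha> (base_zeros m b X) K. f x)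
        \<longlonglongrightarrow> (\<Sum>x\<in>#proots (fps_op A (root_poly X)). f x)"
      by (rule fps_op_LP_limit(3)[OF assms(1-5) pos(1) lim cont])
    show "(\<lambda>K. \<Sum>x\<in>#factor_iter \<alpha> (base_zeros m b Y) K. f x)
        \<longlonglongrightarrow> (\<Sum>x\<in>#proots (fps_op A (root_poly Y)). f x)"
      by (rule fps_op_LP_limit(3)[OF Y assms(2-5) pos(2) lim cont])
    show "\<exists>N. \<forall>K\<ge>N. (\<Sum>x\<in>#factor_iter \<alpha> (base_zeros m b X) K. f x)
        \<le> (\<Sum>x\<in>#factor_iter \<alpha> (base_zeros m b Y) K. f x)"
      using le by blast
  qed
qed

section \<open>Functions convex on the positive half-line only\<close>

lemma majorized_pos_half_line:
  assumes maj: "majorized X Y" and pos: "\<And>x. x \<in># X \<Longrightarrow> 0 < x" "\<And>y. y \<in># Y \<Longrightarrow> 0 < y"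
    and tangent: "\<And>x y. 0 < x \<Longrightarrow> 0 < y \<Longrightarrow> f' x * (y - x) \<le> f y - f x"
  shows "(\<Sum>x\<in>#X. f x) \<le> (\<Sum>y\<in>#Y. f y)"
proof (cases "X = {#}")
  case True
  thus ?thesis using majorized_size[OF maj] by simp
next
  case False
  \<comment> \<open>The tangents at the points of X suffice: g is convex on the whole line, at least
    f on X, and at most f on Y. An empty X was split off because \<open>Max\<close> has no meaning
    there.\<close>
  define g where "g y = Max ((\<lambda>x. f x + f' x * (y - x)) ` set_mset X)" for y
  have ge: "f x + f' x * (y - x) \<le> g y" if "x \<in># X" for x y
    unfolding g_def using that by (intro Max_ge) auto
  have le: "g y \<le> c" if "\<And>x. x \<in># X \<Longrightarrow> f x + f' x * (y - x) \<le> c" for y c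
    unfolding g_def using that False by (intro Max.boundedI) auto
  have "convex_on UNIV g"
  proof (rule convex_onI)
    fix u y z :: real assume u: "0 < u" "u < 1"
    show "g ((1 - u) *\<^sub>R y + u *\<^sub>R z) \<le> (1 - u) * g y + u * g z"
    proof (rule le)
      fix x assume x: "x \<in># X"
      have "f x + f' x * ((1 - u) *\<^sub>R y + u *\<^sub>R z - x)
          = (1 - u) * (f x + f' x * (y - x)) + u * (f x + f' x * (z - x))"
        by (simp add: algebra_simps)
      also have "\<dots> \<le> (1 - u) * g y + u * g z"
        using ge[OF x] u by (intro add_mono mult_left_mono) auto
      finally show "f x + f' x * ((1 - u) *\<^sub>R y + u *\<^sub>R z - x) \<le> (1 - u) * g y + u * g z" .
    qed
  qed simp
  hence "(\<Sum>x\<in>#X. g x) \<le> (\<Sum>y\<in>#Y. g y)" using maj by (simp add: majorized_def)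
  moreover have "(\<Sum>x\<in>#X. f x) \<le> (\<Sum>x\<in>#X. g x)"
    using ge[of x x for x] by (intro sum_mset_mono) auto
  moreover have "g y \<le> f y" if "y \<in># Y" for y
  proof (rule le)
    fix x assume "x \<in># X"
    thus "f x + f' x * (y - x) \<le> f y" using tangent[of x y] pos that by force
  qed
  hence "(\<Sum>y\<in>#Y. g y) \<le> (\<Sum>y\<in>#Y. f y)" by (intro sum_mset_mono) auto
  ultimately show ?thesis by linarith
qed

section \<open>Taylor coefficients of Laguerre-Polya functions\<close>

text \<open>The operators have real coefficients while the convergence argument uses holomorphic
  functions; this embedding links the two.\<close>

definition complex_fps :: "real fps \<Rightarrow> complex fps" where
  "complex_fps F = Abs_fps (\<lambda>k. of_real (fps_nth F k))"

lemma complex_fps_nth [simp]: "fps_nth (complex_fps F) k = of_real (fps_nth F k)"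
  by (simp add: complex_fps_def)

lemma complex_fps_mult: "complex_fps (F * G) = complex_fps F * complex_fps G"
  by (rule fps_ext) (simp add: fps_mult_nth)

lemma complex_fps_diff: "complex_fps (F - G) = complex_fps F - complex_fps G"
  by (rule fps_ext) simp

lemma complex_fps_simps:
  "complex_fps 1 = 1" "complex_fps fps_X = fps_X" "complex_fps (fps_const c) = fps_const (of_real c)"
  "complex_fps (fps_exp b) = fps_exp (of_real b)"
  by (rule fps_ext, simp)+

lemma complex_fps_power: "complex_fps (F ^ n) = complex_fps F ^ n"
  by (induction n) (simp_all add: complex_fps_mult complex_fps_simps)

lemma complex_fps_prod: "complex_fps (prod f A) = (\<Prod>k\<in>A. complex_fps (f k))"
  by (induction A rule: infinite_finite_induct) (simp_all add: complex_fps_mult complex_fps_simps)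

definition LP_partial :: "nat \<Rightarrow> real \<Rightarrow> real \<Rightarrow> (nat \<Rightarrow> real) \<Rightarrow> nat \<Rightarrow> complex \<Rightarrow> complex" where
  "LP_partial m c b \<alpha> K x =
     exp (of_real b * x) * x ^ m * of_real c * (\<Prod>k<K. 1 - of_real (\<alpha> k) * x)"

lemma LP_partial_has_fps_expansion:
  "LP_partial m c b \<alpha> K has_fps_expansion complex_fps (LP_fps m c b \<alpha> K)"
proof -
  have "(\<lambda>x. exp (of_real b * x) * x ^ m * of_real c * (\<Prod>k<K. 1 - of_real (\<alpha> k) * x))
     has_fps_expansion fps_exp (of_real b) * fps_X ^ m * fps_const (of_real c)
       * (\<Prod>k<K. 1 - fps_const (of_real (\<alpha> k)) * fps_X :: complex fps)"
    by (intro fps_expansion_intros)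
  moreover have "LP_partial m c b \<alpha> K =
      (\<lambda>x. exp (of_real b * x) * x ^ m * of_real c * (\<Prod>k<K. 1 - of_real (\<alpha> k) * x))"
    by (simp add: fun_eq_iff LP_partial_def)
  ultimately show ?thesis
    unfolding LP_fps_def complex_fps_mult complex_fps_diff complex_fps_prod complex_fps_power
      complex_fps_simps by simp
qed

text \<open>On the closed unit disc the k-th factor differs from 1 by at most \<alpha> k, so the
  M-test gives uniform convergence of the product. A neighbourhood of 0 is all that Taylor
  coefficients see.\<close>

lemma LP_partial_uniform_limit:
  assumes "summable \<alpha>" "\<And>k. \<alpha> k \<ge> 0"
    and \<phi>: "\<And>x. \<phi> x = of_real c * x ^ m * exp (of_real b * x) * (\<Prod>k. 1 - of_real (\<alpha> k) * x)"
  shows "uniform_limit (cball 0 1) (LP_partial m c b \<alpha>) \<phi> sequentially"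
proof -
  define g where "g K x = (\<Prod>k<K. 1 - of_real (\<alpha> k) * x)" for K and x :: complex
  define h where "h x = exp (of_real b * x) * x ^ m * of_real c" for x :: complex
  have le: "norm (of_real (\<alpha> k) * x) \<le> \<alpha> k" if "x \<in> cball 0 1" for k and x :: complex
    using that assms(2)[of k] by (simp add: norm_mult mult_left_le)
  have "uniformly_convergent_on (cball 0 1) (\<lambda>K x. \<Sum>k<K. norm (1 - of_real (\<alpha> k) * x - 1 :: complex))"
    by (rule Weierstrass_m_test'[OF _ assms(1)]) (use le in auto)
  hence "uniformly_convergent_on (cball 0 1) g"
    unfolding g_def
    by (intro uniformly_convergent_on_prod') (auto intro!: continuous_intros)
  then obtain l where l: "uniform_limit (cball 0 1) g l sequentially"
    by (auto simp: uniformly_convergent_on_def)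
  have l_eq: "l x = (\<Prod>k. 1 - of_real (\<alpha> k) * x)" if x: "x \<in> cball 0 1" for x
  proof (rule LIMSEQ_unique)
    show "(\<lambda>K. g K x) \<longlonglongrightarrow> l x" by (rule tendsto_uniform_limitI[OF l x])
    have "summable (\<lambda>k. norm (1 - of_real (\<alpha> k) * x - 1))"
      by (rule summable_comparison_test'[OF assms(1), of 0]) (use le[OF x] in simp)
    hence "convergent_prod (\<lambda>k. 1 - of_real (\<alpha> k) * x)"
      by (intro abs_convergent_prod_imp_convergent_prod summable_imp_abs_convergent_prod)
    from convergent_prod_LIMSEQ[OF this]
    \<comment> \<open>The partial products of \<open>prodinf\<close> include their last index, those
      of g do not; hence the shift by one.\<close>
    have "(\<lambda>K. g (Suc K) x) \<longlonglongrightarrow> (\<Prod>k. 1 - of_real (\<alpha> k) * x)"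
      by (simp add: g_def lessThan_Suc_atMost)
    thus "(\<lambda>K. g K x) \<longlonglongrightarrow> (\<Prod>k. 1 - of_real (\<alpha> k) * x)"
      by (rule LIMSEQ_imp_Suc)
  qed
  have "continuous_on (cball 0 1) l"
    by (rule uniform_limit_theorem[OF _ l]) (auto simp: g_def intro!: always_eventually continuous_intros)
  hence bl: "bounded (l ` cball 0 1)"
    by (intro compact_imp_bounded compact_continuous_image) auto
  have bh: "bounded (h ` cball 0 1)"
    by (intro compact_imp_bounded compact_continuous_image) (auto simp: h_def intro!: continuous_intros)
  have "uniform_limit (cball 0 1) (\<lambda>K x. h x * g K x) (\<lambda>x. h x * l x) sequentially"
    by (rule uniform_lim_mult[OF uniform_limit_const l bh bl])
  moreover have "(\<lambda>K x. h x * g K x) = LP_partial m c b \<alpha>"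
    by (simp add: fun_eq_iff h_def g_def LP_partial_def)
  moreover have "h x * l x = \<phi> x" if "x \<in> cball 0 1" for x
    using l_eq[OF that] by (simp add: h_def \<phi>)
  ultimately show ?thesis by (metis (mono_tags, lifting) uniform_limit_cong')
qed

text \<open>By Weierstrass' theorem locally uniform convergence of holomorphic functions passes to
  all derivatives at 0. The partial products have real Taylor coefficients, so taking real parts
  recovers them exactly.\<close>

lemma LP''_coefficients:
  assumes "\<phi> \<in> LP'' m"
  obtains c b \<alpha> where "c \<noteq> 0" "b \<le> 0" "\<And>k. \<alpha> k \<ge> 0" "summable \<alpha>"
    "\<And>k. (\<lambda>K. fps_nth (LP_fps m c b \<alpha> K) k) \<longlonglongrightarrow> Re (fps_nth (fps_expansion \<phi> 0) k)"
proof -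
  obtain c b :: real and \<alpha> :: "nat \<Rightarrow> real"
    where *: "c \<noteq> 0" "b \<le> 0" "\<And>k. \<alpha> k \<ge> 0" "summable \<alpha>"
      and \<phi>: "\<And>x. \<phi> x = of_real c * x ^ m * exp (of_real b * x) * (\<Prod>k. 1 - of_real (\<alpha> k) * x)"
    using assms unfolding LP''_def by blast
  have "uniform_limit (ball 0 1) (LP_partial m c b \<alpha>) \<phi> sequentially"
    by (rule uniform_limit_on_subset[OF LP_partial_uniform_limit[OF *(4,3) \<phi>]]) auto
  moreover have "LP_partial m c b \<alpha> K holomorphic_on ball 0 1" for K
    unfolding LP_partial_def[abs_def] by (intro holomorphic_intros)
  ultimately have lim: "(\<lambda>K. (deriv ^^ k) (LP_partial m c b \<alpha> K) 0) \<longlonglongrightarrow> (deriv ^^ k) \<phi> 0" for k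
    by (intro higher_deriv_complex_uniform_limit[where A = "ball 0 1"]) auto
  have "(\<lambda>K. fps_nth (LP_fps m c b \<alpha> K) k) \<longlonglongrightarrow> Re (fps_nth (fps_expansion \<phi> 0) k)" for k
  proof -
    have "(\<lambda>K. Re ((deriv ^^ k) (LP_partial m c b \<alpha> K) 0 / fact k))
        \<longlonglongrightarrow> Re ((deriv ^^ k) \<phi> 0 / fact k)"
      by (intro tendsto_intros lim) auto
    moreover have "Re ((deriv ^^ k) (LP_partial m c b \<alpha> K) 0 / fact k) = fps_nth (LP_fps m c b \<alpha> K) k" for K
      using fps_nth_fps_expansion[OF LP_partial_has_fps_expansion[of m c b \<alpha> K], of k] 
      by (metis Re_complex_of_real complex_fps_nth)
    ultimately show ?thesis by (simp add: fps_expansion_def)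
  qed
  thus ?thesis using that * by blast
qed

section \<open>Real-rooted polynomials as multisets of zeros\<close>

lemma poly_complex_of_real: "poly (map_poly complex_of_real p) (of_real x) = of_real (poly p x)"
  by (induction p) (auto simp: map_poly_pCons)

text \<open>The fundamental theorem of algebra supplies a complex zero, which is real by hypothesis
  and splits off over the reals; the quotient inherits the hypothesis.\<close>

lemma real_rooted_size_proots:
  assumes "p \<noteq> 0" "\<And>z. poly (map_poly complex_of_real p) z = 0 \<Longrightarrow> z \<in> \<real>"
  shows "size (proots p) = degree p"
  using assms
proof (induction "degree p" arbitrary: p)
  case 0
  thus ?case using size_proots_le[of p] by simp
next
  case (Suc n)
  have "degree (map_poly complex_of_real p) = Suc n"
    using Suc.hyps(2) by (simp add: degree_map_poly)
  hence "\<not> constant (poly (map_poly complex_of_real p))" by (simp add: constant_degree)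
  then obtain z where z: "poly (map_poly complex_of_real p) z = 0"
    using fundamental_theorem_of_algebra by blast
  then obtain a where "z = of_real a" using Suc.prems(2) by (auto elim: Reals_cases)
  hence "poly p a = 0" using z by (simp add: poly_complex_of_real)
  then obtain q where q: "p = [:-a, 1:] * q" by (metis dvdE poly_eq_0_iff_dvd)
  have "q \<noteq> 0" using q Suc.prems(1) by auto
  have deg: "degree p = Suc (degree q)"
    unfolding q using \<open>q \<noteq> 0\<close> by (subst degree_mult_eq) auto
  have "proots p = add_mset a (proots q)"
    unfolding q using \<open>q \<noteq> 0\<close> by (subst proots_mult) auto
  moreover have map: "map_poly complex_of_real p = [:-of_real a, 1:] * map_poly complex_of_real q"
    by (rule poly_eqI) (simp add: q coeff_map_poly coeff_pCons split: nat.split)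
  have "size (proots q) = degree q"
  proof (rule Suc.hyps(1))
    show "n = degree q" using Suc.hyps(2) deg by simp
    show "z \<in> \<real>" if "poly (map_poly complex_of_real q) z = 0" for z
      using Suc.prems(2)[of z] that by (simp add: map)
  qed fact
  ultimately show ?case using deg by simp
qed

lemma hyperbolic_eq_root_poly:
  assumes "P \<in> hyperbolic_polys n"
  shows "P = root_poly (proots P)" "size (proots P) = n"
proof -
  have P: "lead_coeff P = 1" "degree P = n"
    and real: "poly (map_poly complex_of_real P) z = 0 \<Longrightarrow> z \<in> \<real>" for z
    using assms by (auto simp: hyperbolic_polys_def)
  have "P \<noteq> 0" using P by auto
  from real_rooted_size_proots[OF this real] show "size (proots P) = n" using P by simp
  hence "size (proots P) = degree P" using P by simp
  from eq_smult_root_poly[OF \<open>P \<noteq> 0\<close> this] show "P = root_poly (proots P)" using P by simp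
qed

lemma sum_zero_of:
  fixes f :: "real \<Rightarrow> real"
  assumes "size (proots P) = N"
  shows "(\<Sum>i=1..N. f (zero_of P i)) = (\<Sum>x\<in>#proots P. f x)"
proof -
  have "(\<Sum>i=1..N. f (zero_of P i)) = (\<Sum>i<N. f (zero_of P (Suc i)))"
    by (rule sum.reindex_bij_witness[of _ Suc "\<lambda>i. i - 1"]) auto
  thus ?thesis by (simp add: zero_of_def sum_mset_sorted_list_of_multiset assms)
qed

theorem corollary11:
  fixes n m :: nat and \<phi> :: "complex \<Rightarrow> complex" and P Q :: "real poly"
  assumes "n \<ge> m + 1"
    and "\<phi> \<in> LP'' m"
    and "P \<in> hyperbolic_polys n" and "Q \<in> hyperbolic_polys n"
    and "\<forall>x. poly P x = 0 \<longrightarrow> x > 0" and "\<forall>x. poly Q x = 0 \<longrightarrow> x > 0"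
    and "poly_spectral_le n Q P"
  shows "((\<Sum>i=1..n-m. zero_of (diff_op \<phi> Q) i * ln (zero_of (diff_op \<phi> Q) i))
           \<le> (\<Sum>i=1..n-m. zero_of (diff_op \<phi> P) i * ln (zero_of (diff_op \<phi> P) i)))
       \<and> (\<forall>k::real. k \<ge> 1 \<longrightarrow>
           (\<Sum>i=1..n-m. zero_of (diff_op \<phi> Q) i powr k)
             \<le> (\<Sum>i=1..n-m. zero_of (diff_op \<phi> P) i powr k))
       \<and> (\<forall>r::real.
           r * (r - 1) * (\<Sum>i=1..n-m. zero_of (diff_op \<phi> Q) i powr r)
             \<le> r * (r - 1) * (\<Sum>i=1..n-m. zero_of (diff_op \<phi> P) i powr r))"
proof -
  define A where "A = Abs_fps (\<lambda>k. Re (fps_nth (fps_expansion \<phi> 0) k))"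
  obtain c b \<alpha> where cb: "c \<noteq> 0" "b \<le> 0" "\<And>k. \<alpha> k \<ge> 0" "summable \<alpha>"
    and "\<And>k. (\<lambda>K. fps_nth (LP_fps m c b \<alpha> K) k) \<longlonglongrightarrow> Re (fps_nth (fps_expansion \<phi> 0) k)"
    using LP''_coefficients[OF assms(2)] by metis
  hence lim: "(\<lambda>K. fps_nth (LP_fps m c b \<alpha> K) k) \<longlonglongrightarrow> fps_nth A k" for k
    by (simp add: A_def)
  have op: "diff_op \<phi> R = fps_op A R" for R
    by (simp add: diff_op_def fps_op_def A_def)
  define X Y where "X = proots Q" and "Y = proots P"
  have X: "Q = root_poly X" "size X = n" and Y: "P = root_poly Y" "size Y = n"
    using hyperbolic_eq_root_poly assms(3,4) by (auto simp: X_def Y_def)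
  have pos: "\<And>x. x \<in># X \<Longrightarrow> 0 < x" "\<And>y. y \<in># Y \<Longrightarrow> 0 < y"
    using assms(5,6) X(1) Y(1) by (metis poly_root_poly_eq_0_iff)+
  have less: "m < size X" "m < size Y" using assms(1) X(2) Y(2) by simp_all
  have maj: "majorized X Y"
    using assms(7) sum_zero_of X(2) Y(2)
    by (simp add: majorized_def poly_spectral_le_def spectral_le_def X_def Y_def)
  define X' Y' where "X' = proots (diff_op \<phi> Q)" and "Y' = proots (diff_op \<phi> P)"
  have maj': "majorized X' Y'"
    unfolding X'_def Y'_def op X(1) Y(1)
    by (rule majorized_fps_op[OF less(1) cb pos lim maj])
  note limX = fps_op_LP_limit(1,2)[OF less(1) cb pos(1) lim, folded X(1) op, folded X'_def]
  note limY = fps_op_LP_limit(1,2)[OF less(2) cb pos(2) lim, folded Y(1) op, folded Y'_def]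
  have pos': "\<And>x. x \<in># X' \<Longrightarrow> 0 < x" "\<And>y. y \<in># Y' \<Longrightarrow> 0 < y"
    using limX(2) limY(2) by auto
  have sumX: "(\<Sum>i=1..n-m. f (zero_of (diff_op \<phi> Q) i)) = (\<Sum>x\<in>#X'. f x)"
    and sumY: "(\<Sum>i=1..n-m. f (zero_of (diff_op \<phi> P) i)) = (\<Sum>x\<in>#Y'. f x)" for f :: "real \<Rightarrow> real"
    using sum_zero_of[of "diff_op \<phi> Q" "n - m" f] sum_zero_of[of "diff_op \<phi> P" "n - m" f]
      limX(1) limY(1) X(2) Y(2) by (simp_all add: X'_def Y'_def)
  note le = majorized_pos_half_line[OF maj' pos']
  have conv: "convex {(0::real)<..}" by simp
  have xlnx: "(\<Sum>x\<in>#X'. x * ln x) \<le> (\<Sum>x\<in>#Y'. x * ln x)"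
  proof (rule le)
    fix x y :: real assume xy: "0 < x" "0 < y"
    show "(ln x + 1) * (y - x) \<le> y * ln y - x * ln x"
      by (rule f''_imp_f'[OF conv, where f'' = "\<lambda>x. 1 / x"])
         (use xy in \<open>auto intro!: derivative_eq_intros simp: field_simps\<close>)
  qed
  \<comment> \<open>Including the factor r (r - 1) in the function gives the second derivative (r (r
    - 1))^2 x^(r - 2) \<ge> 0, so all signs of r (r - 1) are treated at once.\<close>
  have powr: "r * (r - 1) * (\<Sum>x\<in>#X'. x powr r) \<le> r * (r - 1) * (\<Sum>x\<in>#Y'. x powr r)" for r
  proof -
    have "(\<Sum>x\<in>#X'. r * (r - 1) * x powr r) \<le> (\<Sum>x\<in>#Y'. r * (r - 1) * x powr r)"
    proof (rule le)
      fix x y :: real assume xy: "0 < x" "0 < y"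
      show "(r * (r - 1) * (r * x powr (r - 1))) * (y - x)
          \<le> r * (r - 1) * y powr r - r * (r - 1) * x powr r"
      proof (rule f''_imp_f'[OF conv, where f'' = "\<lambda>x. (r * (r - 1))\<^sup>2 * x powr (r - 2)"])
        fix z :: real assume "z \<in> {0<..}"
        hence z: "0 < z" by simp
        show "((\<lambda>x. r * (r - 1) * x powr r) has_real_derivative r * (r - 1) * (r * z powr (r - 1))) (at z)"
          using has_real_derivative_powr[OF z, of r] by (rule DERIV_cmult)
        have "((\<lambda>x. r * (r - 1) * (r * x powr (r - 1))) has_real_derivative
            r * (r - 1) * (r * ((r - 1) * z powr (r - 1 - 1)))) (at z)"
          by (intro DERIV_cmult has_real_derivative_powr z)
        thus "((\<lambda>x. r * (r - 1) * (r * x powr (r - 1))) has_real_derivative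
            (r * (r - 1))\<^sup>2 * z powr (r - 2)) (at z)"
          by (simp add: power2_eq_square mult_ac)
      qed (use xy in auto)
    qed
    moreover have "(\<Sum>x\<in>#M. r * (r - 1) * x powr r) = r * (r - 1) * (\<Sum>x\<in>#M. x powr r)" for M
      by (induction M) (simp_all add: distrib_left)
    ultimately show ?thesis by simp
  qed
  \<comment> \<open>For k > 1 the positive factor k (k - 1) can be cancelled. For k = 1 it vanishes,
    and the claim is the equality of sums contained in majorization.\<close>
  have powr_ge_1: "(\<Sum>x\<in>#X'. x powr k) \<le> (\<Sum>x\<in>#Y'. x powr k)" if "k \<ge> 1" for k
  proof (cases "k = 1")
    case True
    have "image_mset (\<lambda>x. x powr 1) M = M" if "\<And>x. x \<in># M \<Longrightarrow> 0 < x" for M :: "real multiset"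
    proof -
      have "x powr 1 = x" if "x \<in># M" for x using \<open>\<And>x. x \<in># M \<Longrightarrow> 0 < x\<close>[OF that] by simp
      hence "image_mset (\<lambda>x. x powr 1) M = image_mset (\<lambda>x. x) M" by (rule image_mset_cong)
      thus ?thesis by (simp only: image_mset.identity id_apply)
    qed
    hence "(\<Sum>x\<in>#X'. x powr 1) = (\<Sum>x\<in>#Y'. x powr 1)"
      using pos' majorized_sum[OF maj'] by metis
    thus ?thesis unfolding True by (rule eq_refl)
  next
    case False
    hence "0 < k * (k - 1)" using that by simp
    thus ?thesis using powr[of k] by (simp only: mult_le_cancel_left_pos)
  qed
  show ?thesis
    unfolding sumX[of "\<lambda>x. x * ln x"] sumY[of "\<lambda>x. x * ln x"]
      sumX[of "\<lambda>x. x powr _"] sumY[of "\<lambda>x. x powr _"]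
    using xlnx powr powr_ge_1 by blast
qed

end
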